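(* Let $f\colon X\to X$ be a homeomorphism of a compact metric space with the L-shadowing property. Then $f$ has the shadowing property, $f$ has only finitely many chain recurrent classes, and each chain recurrent class $\Lambda$ of $f$ either is expansive (i.e. $f|_\Lambda$ is expansive) or contains arbitrarily small topological semi-horseshoes, i.e. for every $\epsilon>0$ there exist $N\ge1$ and a compact set $K\subset\Lambda$ with $f^N(K)=K$, $\sup_{k\in\mathbb{Z}}\operatorname{diam}(f^k(K))\le\epsilon$, and $f^N|_K$ semi-conjugate to the full shift on two symbols.
   Context: $(X,d)$ compact metric space, $f\colon X\to X$ homeomorphism. A $(\delta,L)$-pseudo orbit is a sequence $(x_k)_{k\in\mathbb{Z}}$ with $d(f(x_k),x_{k+1})\le\delta$ for all $k$ and $d(f(x_k),x_{k+1})\to0$ as $|k|\to\infty$; it is $(\varepsilon,L)$-shadowed by $z$ if $d(f^k(z),x_k)\le\varepsilon$ for all $k$ and $d(f^k(z),x_k)\to0$ as $|k|\to\infty$. $f$ has the L-shadowing property if for every $\varepsilon>0$ there is $\delta>0$ such that every $(\delta,L)$-pseudo orbit is $(\varepsilon,L)$-shadowed. A $\delta$-pseudo-orbit is a sequence $(x_k)_{k\in\mathbb{Z}}$ with $d(f(x_k),x_{k+1})<\delta$ for all $k$; $f$ has the shadowing property if for every $\varepsilon>0$ there is $\delta>0$ such that for every $\delta$-pseudo-orbit there is $y$ with $d(f^k(y),x_k)<\varepsilon$ for all $k\in\mathbb{Z}$. The chain recurrent class of $x$ is the set of $y$ such that for every $\varepsilon>0$ there is a periodic $\varepsilon$-pseudo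 orbit containing both $x$ and $y$. A compact invariant set $\Lambda$ is expansive if there is $c>0$ such that for all distinct $x,y\in\Lambda$ there is $n\in\mathbb{Z}$ with $d(f^n(x),f^n(y))>c$. A map $g\colon K\to K$ is semi-conjugate to the full shift $\sigma$ on $\{0,1\}^{\mathbb{Z}}$ if there is a continuous surjection $h\colon K\to\{0,1\}^{\mathbb{Z}}$ with $h\circ g=\sigma\circ h$. *)

theory Defs
  imports "HOL-Analysis.Analysis"
begin

text \<open>Standing setting: X is a compact subset of a metric space (the compact
metric space), f : X -> X a homeomorphism with inverse g
(homeomorphism X X f g). Integer iterates f^k, negative ones via g.\<close>

definition zit :: "('a \<Rightarrow> 'a) \<Rightarrow> ('a \<Rightarrow> 'a) \<Rightarrow> int \<Rightarrow> 'a \<Rightarrow> 'a" where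
  "zit f g k = (if 0 \<le> k then f ^^ nat k else g ^^ nat (- k))"

definition L_pseudo_orbit ::
  "'a set \<Rightarrow> ('a::metric_space \<Rightarrow> 'a) \<Rightarrow> real \<Rightarrow> (int \<Rightarrow> 'a) \<Rightarrow> bool" where
  "L_pseudo_orbit X f \<delta> x \<longleftrightarrow>
     (\<forall>k. x k \<in> X) \<and>
     (\<forall>k. dist (f (x k)) (x (k + 1)) \<le> \<delta>) \<and>
     ((\<lambda>k. dist (f (x k)) (x (k + 1))) \<longlongrightarrow> 0) at_top \<and>
     ((\<lambda>k. dist (f (x k)) (x (k + 1))) \<longlongrightarrow> 0) at_bot"

definition L_shadowed ::
  "('a::metric_space \<Rightarrow> 'a) \<Rightarrow> ('a \<Rightarrow> 'a) \<Rightarrow> real \<Rightarrow> (int \<Rightarrow> 'a) \<Rightarrow> 'a \<Rightarrow> bool" where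
  "L_shadowed f g \<epsilon> x z \<longleftrightarrow>
     (\<forall>k. dist (zit f g k z) (x k) \<le> \<epsilon>) \<and>
     ((\<lambda>k. dist (zit f g k z) (x k)) \<longlongrightarrow> 0) at_top \<and>
     ((\<lambda>k. dist (zit f g k z) (x k)) \<longlongrightarrow> 0) at_bot"

definition L_shadowing :: "'a set \<Rightarrow> ('a::metric_space \<Rightarrow> 'a) \<Rightarrow> ('a \<Rightarrow> 'a) \<Rightarrow> bool" where
  "L_shadowing X f g \<longleftrightarrow>
     (\<forall>\<epsilon>>0. \<exists>\<delta>>0. \<forall>x. L_pseudo_orbit X f \<delta> x \<longrightarrow>
        (\<exists>z\<in>X. L_shadowed f g \<epsilon> x z))"

definition shadowing :: "'a set \<Rightarrow> ('a::metric_space \<Rightarrow> 'a) \<Rightarrow> ('a \<Rightarrow> 'a) \<Rightarrow> bool" where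
  "shadowing X f g \<longleftrightarrow>
     (\<forall>\<epsilon>>0. \<exists>\<delta>>0. \<forall>x::int \<Rightarrow> 'a.
        (\<forall>k. x k \<in> X) \<and> (\<forall>k. dist (f (x k)) (x (k + 1)) < \<delta>) \<longrightarrow>
        (\<exists>y\<in>X. \<forall>k. dist (zit f g k y) (x k) < \<epsilon>))"

definition periodic_po_through ::
  "'a set \<Rightarrow> ('a::metric_space \<Rightarrow> 'a) \<Rightarrow> real \<Rightarrow> 'a \<Rightarrow> 'a \<Rightarrow> bool" where
  "periodic_po_through X f \<epsilon> x y \<longleftrightarrow>
     (\<exists>n::nat. \<exists>p::nat \<Rightarrow> 'a. 1 \<le> n \<and> (\<forall>i\<le>n. p i \<in> X) \<and> p n = p 0 \<and>
        (\<forall>i<n. dist (f (p i)) (p (Suc i)) < \<epsilon>) \<and>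
        (\<exists>i<n. p i = x) \<and> (\<exists>j<n. p j = y))"

definition chain_class :: "'a set \<Rightarrow> ('a::metric_space \<Rightarrow> 'a) \<Rightarrow> 'a \<Rightarrow> 'a set" where
  "chain_class X f x = {y \<in> X. \<forall>\<epsilon>>0. periodic_po_through X f \<epsilon> x y}"

text \<open>The chain recurrent classes: classes of chain recurrent points (x in its own class).\<close>
definition chain_classes :: "'a set \<Rightarrow> ('a::metric_space \<Rightarrow> 'a) \<Rightarrow> 'a set set" where
  "chain_classes X f = {chain_class X f x | x. x \<in> X \<and> x \<in> chain_class X f x}"

definition expansive_set :: "('a::metric_space \<Rightarrow> 'a) \<Rightarrow> ('a \<Rightarrow> 'a) \<Rightarrow> 'a set \<Rightarrow> bool" where
  "expansive_set f g \<Lambda> \<longleftrightarrow>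
     (\<exists>c>0. \<forall>x\<in>\<Lambda>. \<forall>y\<in>\<Lambda>. x \<noteq> y \<longrightarrow> (\<exists>n::int. dist (zit f g n x) (zit f g n y) > c))"

definition shift_top :: "(int \<Rightarrow> bool) topology" where
  "shift_top = product_topology (\<lambda>_. discrete_topology UNIV) UNIV"

definition shift :: "(int \<Rightarrow> bool) \<Rightarrow> (int \<Rightarrow> bool)" where
  "shift s = (\<lambda>k. s (k + 1))"

definition semiconj_full_shift :: "'a::metric_space set \<Rightarrow> ('a \<Rightarrow> 'a) \<Rightarrow> bool" where
  "semiconj_full_shift K G \<longleftrightarrow>
     (\<exists>h. continuous_map (top_of_set K) shift_top h \<and> h ` K = UNIV \<and>
          (\<forall>x\<in>K. h (G x) = shift (h x)))"

definition small_semi_horseshoes :: "('a::metric_space \<Rightarrow> 'a) \<Rightarrow> ('a \<Rightarrow> 'a) \<Rightarrow> 'a set \<Rightarrow> bool" where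
  "small_semi_horseshoes f g \<Lambda> \<longleftrightarrow>
     (\<forall>\<epsilon>>0. \<exists>N::nat. \<exists>K. 1 \<le> N \<and> K \<subseteq> \<Lambda> \<and> compact K \<and> (f ^^ N) ` K = K \<and>
        (\<forall>k::int. diameter (zit f g k ` K) \<le> \<epsilon>) \<and>
        semiconj_full_shift K (f ^^ N))"

end

theory Submission
  imports Defs
begin

text \<open>
Replacing the tails of a pseudo orbit by true orbits and passing to a limit gives shadowing.
If \<open>x, y\<close> are chain recurrent and close, a point following \<open>x\<close> in the past and \<open>y\<close> in the future
connects their classes; hence close chain recurrent points lie in the same class, and compactness
leaves finitely many classes.

If a class \<open>\<Lambda>\<close> is not expansive, it has distinct points \<open>x, y\<close> whose orbits stay close. These are turned
into distinct close points \<open>a, b\<close> that are asymptotic in both directions. If the orbits come arbitrarily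
close in both directions, follow \<open>x\<close> except for a long stretch of \<open>y\<close>. If they stay apart in the future,
take a limit \<open>(p, q)\<close> of the pairs \<open>(f\<^sup>n x, f\<^sup>n y)\<close>, let \<open>z\<close> follow \<open>x\<close> and then \<open>y\<close>, let \<open>w\<close> follow \<open>p\<close>
and then \<open>q\<close>, and switch from the pair \<open>(x, z)\<close> to the pair \<open>(w, q)\<close> far out, where
\<open>z\<close> is near \<open>y\<close> and \<open>w\<close> is near \<open>p\<close>; the past is analogous.

Finally join each of the two orbit segments of \<open>a\<close> and \<open>b\<close> to a chain leading back from
\<open>f\<^sup>m a\<close> to the starting region. Every bi-infinite sequence of these two loops is a pseudo orbit, and
the set \<open>K\<close> of all points shadowing such sequences is the semi-horseshoe. Orbits in \<open>K\<close> accumulate, in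
both time directions, at chain recurrent points near \<open>a\<close>, which places \<open>K\<close> in \<open>\<Lambda>\<close>.
\<close>

section \<open>Integer iterates of a homeomorphism of a compact space\<close>

locale compact_homeo =
  fixes X :: "'a::metric_space set" and f g :: "'a \<Rightarrow> 'a"
  assumes cpt: "compact X" and homeo: "homeomorphism X X f g"
begin

abbreviation F :: "int \<Rightarrow> 'a \<Rightarrow> 'a" where "F \<equiv> zit f g"

lemma f_in: "x \<in> X \<Longrightarrow> f x \<in> X"
  and g_in: "x \<in> X \<Longrightarrow> g x \<in> X"
  and gf: "x \<in> X \<Longrightarrow> g (f x) = x"
  and fg: "x \<in> X \<Longrightarrow> f (g x) = x"
  using homeo unfolding homeomorphism_def by auto

lemma F_0 [simp]: "F 0 x = x"
  by (simp add: zit_def)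

lemma F_nat: "F (int n) = f ^^ n"
  by (simp add: zit_def)

lemma F_in: assumes "x \<in> X" shows "F k x \<in> X"
proof -
  have "(f ^^ n) x \<in> X" "(g ^^ n) x \<in> X" for n
    by (induction n) (auto simp: f_in g_in assms)
  then show ?thesis by (simp add: zit_def)
qed

lemma F_Suc: assumes "x \<in> X" shows "F (k + 1) x = f (F k x)"
proof (cases "0 \<le> k")
  case True
  then show ?thesis by (simp add: zit_def nat_add_distrib)
next
  case False
  then have "k = - int (Suc (nat (- k - 1)))" by simp
  then obtain m where m: "k = - int (Suc m)" by blast
  have "F (- int m) x \<in> X" by (rule F_in[OF assms])
  then have "(g ^^ m) x \<in> X"
    by (cases "m = 0") (auto simp: zit_def)
  then show ?thesis
    using m by (auto simp: zit_def fg nat_add_distrib)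
qed

lemma F_pred: assumes "x \<in> X" shows "F (k - 1) x = g (F k x)"
  using F_Suc[OF assms, of "k - 1"] gf[OF F_in[OF assms, of "k - 1"]] by simp

lemma F_add: assumes "x \<in> X" shows "F (j + k) x = F j (F k x)"
proof (induction j rule: int_induct[where k = 0])
  case base
  then show ?case by simp
next
  case (step1 i)
  then show ?case
    using F_Suc[OF assms, of "i + k"] F_Suc[OF F_in[OF assms, of k], of i]
    by (simp add: algebra_simps)
next
  case (step2 i)
  then show ?case
    using F_pred[OF assms, of "i + k"] F_pred[OF F_in[OF assms, of k], of i]
    by (simp add: algebra_simps)
qed

lemma F_cont: "continuous_on X (F k)"
proof -
  have cf: "continuous_on X f" and cg: "continuous_on X g"
    using homeo by (auto simp: homeomorphism_def)
  show ?thesis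
  proof (induction k rule: int_induct[where k = 0])
    case base
    then show ?case by (simp add: continuous_on_id cong: continuous_on_cong)
  next
    case (step1 i)
    have "continuous_on X (\<lambda>x. f (F i x))"
      by (rule continuous_on_compose2[OF cf step1(2)]) (auto simp: F_in)
    then show ?case by (rule continuous_on_eq) (simp add: F_Suc)
  next
    case (step2 i)
    have "continuous_on X (\<lambda>x. g (F i x))"
      by (rule continuous_on_compose2[OF cg step2(2)]) (auto simp: F_in)
    then show ?case by (rule continuous_on_eq) (simp add: F_pred)
  qed
qed

lemma F_tendsto:
  assumes "\<And>n. s n \<in> X" "s \<longlonglongrightarrow> y" "y \<in> X"
  shows "(\<lambda>n. F k (s n)) \<longlonglongrightarrow> F k y"
  using F_cont[of k] assms by (auto simp: continuous_on_sequentially o_def)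

lemma F_uniform:
  assumes "e > 0"
  obtains d where "d > 0" "\<And>x y. x \<in> X \<Longrightarrow> y \<in> X \<Longrightarrow> dist x y < d \<Longrightarrow> dist (F k x) (F k y) < e"
  using compact_uniformly_continuous[OF F_cont cpt, of k] assms
  unfolding uniformly_continuous_on_def by (metis dist_commute)

lemma F_1: "F 1 x = f x" and F_minus_1: "F (- 1) x = g x"
  by (simp_all add: zit_def)

lemma f_uniform:
  assumes "e > 0"
  obtains d where "d > 0" "\<And>x y. x \<in> X \<Longrightarrow> y \<in> X \<Longrightarrow> dist x y < d \<Longrightarrow> dist (f x) (f y) < e"
  using F_uniform[OF assms, of 1] unfolding F_1 by metis

subsection \<open>Chains\<close>

text \<open>Chains become paths of a relation, so concatenation is transitivity of
  \<open>trancl\<close>, and membership in \<open>X\<close> comes with every jump.\<close>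

definition step :: "real \<Rightarrow> ('a \<times> 'a) set" where
  "step e = {(a, b). a \<in> X \<and> b \<in> X \<and> dist (f a) b < e}"

text \<open>With \<open>trancl\<close> instead of its reflexive version a chain has at least one
  jump, so \<open>reach x x\<close> means that \<open>x\<close> is chain recurrent.\<close>

definition reach :: "'a \<Rightarrow> 'a \<Rightarrow> bool" where
  "reach x y \<longleftrightarrow> (\<forall>e>0. (x, y) \<in> (step e)\<^sup>+)"

lemma step_mono: "d \<le> e \<Longrightarrow> step d \<subseteq> step e"
  by (auto simp: step_def)

lemma trancl_step_mono: "d \<le> e \<Longrightarrow> (x, y) \<in> (step d)\<^sup>+ \<Longrightarrow> (x, y) \<in> (step e)\<^sup>+"
  using step_mono trancl_mono by blast

lemma reach_trans: "reach x y \<Longrightarrow> reach y z \<Longrightarrow> reach x z"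
  unfolding reach_def by (meson trancl_trans)

text \<open>Two chains, one in each direction, close up to a periodic pseudo orbit; conversely,
  going round the cycle leads from any of its points to any other.\<close>

lemma periodic_po_through_iff:
  "periodic_po_through X f e x y \<longleftrightarrow> (x, y) \<in> (step e)\<^sup>+ \<and> (y, x) \<in> (step e)\<^sup>+"
proof
  assume "periodic_po_through X f e x y"
  then obtain n p i j where np: "1 \<le> n" "\<forall>i\<le>n. p i \<in> X" "p n = p 0"
      "\<forall>i<n. dist (f (p i)) (p (Suc i)) < e"
    and i: "i < n" "p i = x" and j: "j < n" "p j = y"
    unfolding periodic_po_through_def by blast
  have *: "(p i, p j) \<in> (step e)\<^sup>+" if "i < j" "j \<le> n" for i j
    using that
  proof (induction j)
    case (Suc j)
    have "(p j, p (Suc j)) \<in> step e" using Suc.prems np by (simp add: step_def)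
    then show ?case using Suc by (cases "i = j") (auto intro: trancl_into_trancl)
  qed simp
  have "(p i, p j) \<in> (step e)\<^sup>+" if "i < n" "j < n" for i j
  proof -
    \<comment> \<open>Running first to the end \<open>p n = p 0\<close> and then on to
      \<open>p j\<close> treats every order of \<open>i\<close> and \<open>j\<close> alike.\<close>
    have 1: "(p i, p 0) \<in> (step e)\<^sup>+" using *[of i n] that np by simp
    show ?thesis
    proof (cases "j = 0")
      case False
      with *[of 0 j] that have "(p 0, p j) \<in> (step e)\<^sup>+" by simp
      with 1 show ?thesis by (rule trancl_trans)
    qed (use 1 in simp)
  qed
  then show "(x, y) \<in> (step e)\<^sup>+ \<and> (y, x) \<in> (step e)\<^sup>+"
    using i j by blast
next
  assume "(x, y) \<in> (step e)\<^sup>+ \<and> (y, x) \<in> (step e)\<^sup>+"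
  then obtain n m u v where u: "0 < n" "u 0 = x" "u n = y" "\<forall>i<n. (u i, u (Suc i)) \<in> step e"
    and v: "0 < m" "v 0 = y" "v m = x" "\<forall>i<m. (v i, v (Suc i)) \<in> step e"
    by (auto simp: trancl_power relpow_fun_conv)
  define p where "p i = (if i < n then u i else v (i - n))" for i
  have st: "(p i, p (Suc i)) \<in> step e" if "i < n + m" for i
  proof -
    consider "Suc i < n" | "Suc i = n" | "n \<le> i" by linarith
    then show ?thesis
    proof cases
      case 1
      then show ?thesis using u(4) by (auto simp: p_def)
    next
      case 2
      then show ?thesis using u(3,4) v(2) by (auto simp: p_def)
    next
      case 3
      then have "(v (i - n), v (Suc (i - n))) \<in> step e" using v that by simp
      then show ?thesis using 3 by (simp add: p_def Suc_diff_le)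
    qed
  qed
  have pe: "p (n + m) = p 0" using u v by (simp add: p_def)
  have pX: "p i \<in> X" if "i \<le> n + m" for i
  proof (cases "i = n + m")
    case True
    then show ?thesis using st[of 0] pe u by (simp add: step_def)
  next
    case False
    then show ?thesis using st[of i] that by (simp add: step_def)
  qed
  show "periodic_po_through X f e x y"
    unfolding periodic_po_through_def
  proof (rule exI[of _ "n + m"], rule exI[of _ p], intro conjI allI impI)
    show "dist (f (p i)) (p (Suc i)) < e" if "i < n + m" for i
      using st[OF that] by (simp add: step_def)
    show "\<exists>i<n + m. p i = x" using u by (intro exI[of _ 0]) (simp add: p_def)
    show "\<exists>j<n + m. p j = y" using v by (intro exI[of _ n]) (simp add: p_def)
  qed (use u pe pX in auto)
qed

lemma chain_class_eq: "chain_class X f x = {y \<in> X. reach x y \<and> reach y x}"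
  by (auto simp: chain_class_def reach_def periodic_po_through_iff)

lemma reach_in: assumes "reach x y" shows "x \<in> X" "y \<in> X"
proof -
  have "(x, y) \<in> (step 1)\<^sup>+" using assms by (simp add: reach_def)
  then show "x \<in> X" "y \<in> X"
    by (auto elim: tranclE converse_tranclE simp: step_def)
qed

lemma trancl_step_end:
  assumes "(x, y) \<in> (step d)\<^sup>+" "y' \<in> X" "dist y y' < d'"
  shows "(x, y') \<in> (step (d + d'))\<^sup>+"
proof -
  have d': "0 \<le> d'" using assms(3) zero_le_dist[of y y'] by linarith
  obtain p where p: "p = x \<or> (x, p) \<in> (step d)\<^sup>+" "(p, y) \<in> step d"
    using assms(1) by (auto elim: tranclE)
  have "(p, y') \<in> step (d + d')"
    using p(2) assms dist_triangle[of "f p" y' y] by (auto simp: step_def)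
  moreover have "p = x \<or> (x, p) \<in> (step (d + d'))\<^sup>+"
    using p(1) trancl_step_mono[of d "d + d'"] d' by auto
  ultimately show ?thesis by (auto intro: trancl_into_trancl)
qed

text \<open>The first jump depends on its start only through \<open>f x\<close>, which is why
  closeness is asked of the images.\<close>

lemma trancl_step_start:
  assumes "(x, y) \<in> (step d)\<^sup>+" "x' \<in> X" "dist (f x') (f x) < d'"
  shows "(x', y) \<in> (step (d + d'))\<^sup>+"
proof -
  have d': "0 \<le> d'" using assms(3) zero_le_dist[of "f x'" "f x"] by linarith
  obtain p where p: "p = y \<or> (p, y) \<in> (step d)\<^sup>+" "(x, p) \<in> step d"
    using assms(1) by (auto elim: converse_tranclE)
  have "(x', p) \<in> step (d + d')"
    using p(2) assms dist_triangle[of "f x'" p "f x"] by (auto simp: step_def)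
  moreover have "p = y \<or> (p, y) \<in> (step (d + d'))\<^sup>+"
    using p(1) trancl_step_mono[of d "d + d'"] d' by auto
  ultimately show ?thesis by (auto intro: trancl_into_trancl2)
qed

lemma trancl_orbit:
  assumes "x \<in> X" "0 < e"
  shows "(x, (f ^^ Suc n) x) \<in> (step e)\<^sup>+"
proof -
  have st: "((f ^^ n) x, (f ^^ Suc n) x) \<in> step e" for n
    using assms F_in[of x "int n"] F_in[of x "int (Suc n)"]
    by (simp add: step_def F_nat del: of_nat_Suc)
  show ?thesis
  proof (induction n)
    case 0
    then show ?case using st[of 0] by auto
  next
    case (Suc n)
    then show ?case using st[of "Suc n"] by (rule trancl_into_trancl)
  qed
qed

text \<open>A chain between nearby points is repaired at its first and last jump. One third of
  \<open>e\<close> pays for the given chain, one for moving its end and one for moving its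
  start.\<close>

lemma reach_lim:
  assumes "x \<in> X" "y \<in> X"
    and *: "\<And>d. d > 0 \<Longrightarrow> \<exists>x' y'. x' \<in> X \<and> dist x' x < d \<and> dist y' y < d \<and> (\<forall>e>0. (x', y') \<in> (step e)\<^sup>+)"
  shows "reach x y"
  unfolding reach_def
proof (intro allI impI)
  fix e :: real assume e: "e > 0"
  obtain d where d: "d > 0" "\<And>x y. x \<in> X \<Longrightarrow> y \<in> X \<Longrightarrow> dist x y < d \<Longrightarrow> dist (f x) (f y) < e / 3"
    using f_uniform[of "e / 3"] e by auto
  obtain x' y' where xy: "x' \<in> X" "dist x' x < min d (e / 3)" "dist y' y < min d (e / 3)"
    "(x', y') \<in> (step (e / 3))\<^sup>+"
    using *[of "min d (e / 3)"] d e by (metis (no_types) divide_pos_pos min_less_iff_conj zero_less_numeral)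
  have "(x', y) \<in> (step (e / 3 + e / 3))\<^sup>+"
    by (rule trancl_step_end[OF xy(4) assms(2)]) (use xy in simp)
  moreover have "dist (f x) (f x') < e / 3"
    using d(2)[OF assms(1) xy(1)] xy by (simp add: dist_commute)
  ultimately have "(x, y) \<in> (step (e / 3 + e / 3 + e / 3))\<^sup>+"
    using trancl_step_start assms(1) by blast
  then show "(x, y) \<in> (step e)\<^sup>+" by simp
qed

text \<open>An orbit segment of positive length is a chain for every error bound.\<close>

lemma reach_F_lim:
  assumes "x \<in> X" "y \<in> X"
    and *: "\<And>d. d > 0 \<Longrightarrow> \<exists>z n. z \<in> X \<and> 0 < n \<and> dist z x < d \<and> dist (F n z) y < d"
  shows "reach x y"
proof (rule reach_lim[OF assms(1,2)])
  fix d :: real assume "d > 0"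
  with * obtain z n where z: "z \<in> X" "0 < n" "dist z x < d" "dist (F n z) y < d" by blast
  have "n = int (Suc (nat (n - 1)))" using z by simp
  then have "F n z = (f ^^ Suc (nat (n - 1))) z"
    using F_nat[of "Suc (nat (n - 1))"] by metis
  then have "\<forall>e>0. (z, F n z) \<in> (step e)\<^sup>+"
    using trancl_orbit[OF z(1)] by simp
  then show "\<exists>x' y'. x' \<in> X \<and> dist x' x < d \<and> dist y' y < d \<and> (\<forall>e>0. (x', y') \<in> (step e)\<^sup>+)"
    using z by blast
qed

lemma reach_tendsto_right:
  assumes "\<And>n. reach x (s n)" "s \<longlonglongrightarrow> y" "y \<in> X"
  shows "reach x y"
proof (rule reach_lim)
  show "x \<in> X" using reach_in assms(1) by blast
  fix d :: real assume "d > 0"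
  then obtain n where "dist (s n) y < d" using assms(2) by (meson lim_sequentially order_refl)
  then show "\<exists>x' y'. x' \<in> X \<and> dist x' x < d \<and> dist y' y < d \<and> (\<forall>e>0. (x', y') \<in> (step e)\<^sup>+)"
    using assms(1)[of n] \<open>d > 0\<close> reach_in(1) unfolding reach_def
    by (intro exI[of _ x] exI[of _ "s n"]) (auto simp: \<open>x \<in> X\<close>)
qed (use assms in auto)

lemma reach_tendsto_left:
  assumes "\<And>n. reach (s n) y" "s \<longlonglongrightarrow> x" "x \<in> X"
  shows "reach x y"
proof (rule reach_lim)
  show "y \<in> X" using reach_in assms(1) by blast
  fix d :: real assume "d > 0"
  then obtain n where "dist (s n) x < d" using assms(2) by (meson lim_sequentially order_refl)
  then show "\<exists>x' y'. x' \<in> X \<and> dist x' x < d \<and> dist y' y < d \<and> (\<forall>e>0. (x', y') \<in> (step e)\<^sup>+)"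
    using assms(1)[of n] \<open>d > 0\<close> reach_in[OF assms(1)[of n]] unfolding reach_def
    by (intro exI[of _ "s n"] exI[of _ y]) auto
qed (use assms in auto)

text \<open>To return from \<open>f x\<close>, take a chain from \<open>x\<close> to itself: its
  second point \<open>p\<close> is close to \<open>f x\<close>, so \<open>f x\<close> can replace
  \<open>p\<close> as a start.\<close>

lemma reach_f:
  assumes "reach x x"
  shows "reach x (f x)" "reach (f x) x"
proof -
  have x: "x \<in> X" using reach_in assms by blast
  show "reach x (f x)"
    unfolding reach_def using trancl_orbit[OF x, of _ 0] by simp
  show "reach (f x) x"
    unfolding reach_def
  proof (intro allI impI)
    fix e :: real assume e: "e > 0"
    obtain d where d: "d > 0" "\<And>x y. x \<in> X \<Longrightarrow> y \<in> X \<Longrightarrow> dist x y < d \<Longrightarrow> dist (f x) (f y) < e / 2"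
      using f_uniform[of "e / 2"] e by auto
    define r where "r = min d (e / 2)"
    have "r > 0" using d e by (simp add: r_def)
    then have c: "(x, x) \<in> (step r)\<^sup>+" using assms by (simp add: reach_def)
    \<comment> \<open>If the chain is a single jump, then \<open>p = x\<close> and the whole chain
      serves again as the continuation.\<close>
    then obtain p where p: "(x, p) \<in> step r" "(p, x) \<in> (step r)\<^sup>+"
      by (metis converse_tranclE)
    have "(p, x) \<in> (step (e / 2))\<^sup>+"
      using p(2) by (rule trancl_step_mono[rotated]) (simp add: r_def)
    moreover have "dist (f (f x)) (f p) < e / 2"
      using p(1) by (intro d(2)) (auto simp: step_def r_def f_in)
    ultimately have "(f x, x) \<in> (step (e / 2 + e / 2))\<^sup>+"
      using trancl_step_start f_in x by blast
    then show "(f x, x) \<in> (step e)\<^sup>+" by simp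
  qed
qed

text \<open>The time-reversed argument: on a closed chain the last point \<open>p\<close> before
  \<open>x\<close> is close to \<open>g x\<close> by uniform continuity of \<open>g\<close>, so the
  chain may end at \<open>g x\<close> instead.\<close>

lemma reach_g:
  assumes "reach x x"
  shows "reach x (g x)" "reach (g x) x"
proof -
  have x: "x \<in> X" using reach_in assms by blast
  show "reach (g x) x"
    unfolding reach_def using trancl_orbit[OF g_in[OF x], of _ 0] by (simp add: fg x)
  show "reach x (g x)"
    unfolding reach_def
  proof (intro allI impI)
    fix e :: real assume e: "e > 0"
    obtain d where d: "d > 0" "\<And>x y. x \<in> X \<Longrightarrow> y \<in> X \<Longrightarrow> dist x y < d \<Longrightarrow> dist (g x) (g y) < e / 2"
      using F_uniform[of "e / 2" "- 1"] e unfolding F_minus_1 by auto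
    define r where "r = min d (e / 2)"
    have "r > 0" using d e by (simp add: r_def)
    then have c: "(x, x) \<in> (step r)\<^sup>+" using assms by (simp add: reach_def)
    then obtain p where p: "(p, x) \<in> step r" "(x, p) \<in> (step r)\<^sup>+"
      by (metis tranclE)
    have "(x, p) \<in> (step (e / 2))\<^sup>+"
      using p(2) by (rule trancl_step_mono[rotated]) (simp add: r_def)
    moreover have "dist (g (f p)) (g x) < e / 2"
      using p(1) by (intro d(2)) (auto simp: step_def r_def f_in)
    then have "dist p (g x) < e / 2" using p(1) by (simp add: step_def gf)
    ultimately have "(x, g x) \<in> (step (e / 2 + e / 2))\<^sup>+"
      using trancl_step_end g_in x by blast
    then show "(x, g x) \<in> (step e)\<^sup>+" by simp
  qed
qed

lemma reach_F:
  assumes "reach x x"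
  shows "reach x (F k x)" "reach (F k x) x"
proof -
  have x: "x \<in> X" using reach_in assms by blast
  have "reach x (F k x) \<and> reach (F k x) x"
  proof (induction k rule: int_induct[where k = 0])
    case base
    then show ?case using assms by simp
  next
    case (step1 i)
    then show ?case
      using reach_f[of "F i x"] reach_trans by (metis F_Suc x)
  next
    case (step2 i)
    then show ?case
      using reach_g[of "F i x"] reach_trans by (metis F_pred x)
  qed
  then show "reach x (F k x)" "reach (F k x) x" by auto
qed

subsection \<open>Asymptotic points\<close>

definition fwd_asymp :: "'a \<Rightarrow> 'a \<Rightarrow> bool" where
  "fwd_asymp x y \<longleftrightarrow> (\<forall>e>0. \<exists>M. \<forall>k\<ge>M. dist (F k x) (F k y) < e)"

definition bwd_asymp :: "'a \<Rightarrow> 'a \<Rightarrow> bool" where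
  "bwd_asymp x y \<longleftrightarrow> (\<forall>e>0. \<exists>M. \<forall>k\<le>M. dist (F k x) (F k y) < e)"

lemma fwd_asymp_sym: "fwd_asymp x y \<Longrightarrow> fwd_asymp y x" and bwd_asymp_sym: "bwd_asymp x y \<Longrightarrow> bwd_asymp y x"
  by (simp_all add: fwd_asymp_def bwd_asymp_def dist_commute)

lemma fwd_asymp_trans: assumes "fwd_asymp x y" "fwd_asymp y z" shows "fwd_asymp x z"
  unfolding fwd_asymp_def
proof (intro allI impI)
  fix e :: real assume "e > 0"
  then obtain M M' where M: "\<And>k. k \<ge> M \<Longrightarrow> dist (F k x) (F k y) < e / 2"
    "\<And>k. k \<ge> M' \<Longrightarrow> dist (F k y) (F k z) < e / 2"
    using assms unfolding fwd_asymp_def by (meson half_gt_zero)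
  then show "\<exists>M. \<forall>k\<ge>M. dist (F k x) (F k z) < e"
    by (intro exI[of _ "max M M'"]) (metis dist_commute dist_triangle_half_l max.bounded_iff)
qed

lemma bwd_asymp_trans: assumes "bwd_asymp x y" "bwd_asymp y z" shows "bwd_asymp x z"
  unfolding bwd_asymp_def
proof (intro allI impI)
  fix e :: real assume "e > 0"
  then obtain M M' where M: "\<And>k. k \<le> M \<Longrightarrow> dist (F k x) (F k y) < e / 2"
    "\<And>k. k \<le> M' \<Longrightarrow> dist (F k y) (F k z) < e / 2"
    using assms unfolding bwd_asymp_def by (meson half_gt_zero)
  then show "\<exists>M. \<forall>k\<le>M. dist (F k x) (F k z) < e"
    by (intro exI[of _ "min M M'"]) (metis dist_commute dist_triangle_half_l min.bounded_iff)
qed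

lemma fwd_asymp_shift: assumes "x \<in> X" "y \<in> X" "fwd_asymp x y" shows "fwd_asymp (F n x) (F n y)"
  unfolding fwd_asymp_def
proof (intro allI impI)
  fix e :: real assume "e > 0"
  then obtain M where "\<forall>k\<ge>M. dist (F k x) (F k y) < e"
    using assms(3) by (auto simp: fwd_asymp_def)
  then show "\<exists>M. \<forall>k\<ge>M. dist (F k (F n x)) (F k (F n y)) < e"
    using assms by (intro exI[of _ "M - n"]) (simp flip: F_add)
qed

lemma bwd_asymp_shift: assumes "x \<in> X" "y \<in> X" "bwd_asymp x y" shows "bwd_asymp (F n x) (F n y)"
  unfolding bwd_asymp_def
proof (intro allI impI)
  fix e :: real assume "e > 0"
  then obtain M where "\<forall>k\<le>M. dist (F k x) (F k y) < e"
    using assms(3) by (auto simp: bwd_asymp_def)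
  then show "\<exists>M. \<forall>k\<le>M. dist (F k (F n x)) (F k (F n y)) < e"
    using assms by (intro exI[of _ "M - n"]) (simp flip: F_add)
qed

text \<open>The times \<open>t\<close> are left free, so that they can later be chosen as visits to
  a prescribed region, which the limit then inherits.\<close>

lemma omega_limit:
  fixes t :: "nat \<Rightarrow> int"
  assumes z: "z \<in> X" and t: "\<And>M. \<exists>n0. \<forall>n\<ge>n0. M \<le> t n"
  obtains w r where "w \<in> X" "strict_mono r" "(\<lambda>n. F (t (r n)) z) \<longlonglongrightarrow> w"
    "reach z w" "reach w w"
proof -
  have "\<forall>n. F (t n) z \<in> X" by (simp add: F_in[OF z])
  then have "\<exists>w\<in>X. \<exists>r. strict_mono (r :: nat \<Rightarrow> nat) \<and> ((\<lambda>n. F (t n) z) \<circ> r) \<longlonglongrightarrow> w"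
    using cpt[unfolded compact_def, THEN spec, of "\<lambda>n. F (t n) z"] by blast
  then obtain w r where w: "w \<in> X" "strict_mono (r :: nat \<Rightarrow> nat)" "(\<lambda>n. F (t (r n)) z) \<longlonglongrightarrow> w"
    by (auto simp: o_def)
  have near: "\<exists>k\<ge>M. dist (F k z) w < d" if "d > 0" for d M
  proof -
    obtain n0 where n0: "\<forall>n\<ge>n0. M \<le> t n" using t by blast
    obtain n1 where n1: "\<forall>n\<ge>n1. dist (F (t (r n)) z) w < d"
      using w(3) \<open>d > 0\<close> by (meson lim_sequentially)
    have "n0 \<le> r (max n0 n1)"
      using seq_suble[OF w(2), of "max n0 n1"] by linarith
    then show ?thesis using n0 n1 by (intro exI[of _ "t (r (max n0 n1))"]) auto
  qed
  have "reach z w"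
  proof (rule reach_F_lim[OF z w(1)])
    fix d :: real assume "d > 0"
    then obtain k where "k \<ge> 1" "dist (F k z) w < d" using near by blast
    then show "\<exists>u n. u \<in> X \<and> 0 < n \<and> dist u z < d \<and> dist (F n u) w < d"
      using z \<open>d > 0\<close> by (intro exI[of _ z] exI[of _ k]) auto
  qed
  \<comment> \<open>Two visits near \<open>w\<close> at different times cut out an orbit segment
    from near \<open>w\<close> to near \<open>w\<close>.\<close>
  moreover have "reach w w"
  proof (rule reach_F_lim[OF w(1) w(1)])
    fix d :: real assume "d > 0"
    then obtain k where "dist (F k z) w < d" using near by blast
    moreover obtain l where "l \<ge> k + 1" "dist (F l z) w < d"
      using near[OF \<open>d > 0\<close>] by blast
    ultimately show "\<exists>u n. u \<in> X \<and> 0 < n \<and> dist u w < d \<and> dist (F n u) w < d"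
      using z by (intro exI[of _ "F k z"] exI[of _ "l - k"]) (auto simp: F_in simp flip: F_add)
  qed
  ultimately show ?thesis using that w by blast
qed

text \<open>Mirror image of \<open>omega_limit\<close>: a visit near \<open>w\<close> at a negative
  time starts an orbit segment that ends at \<open>z\<close>.\<close>

lemma alpha_limit:
  fixes t :: "nat \<Rightarrow> int"
  assumes z: "z \<in> X" and t: "\<And>M. \<exists>n0. \<forall>n\<ge>n0. t n \<le> M"
  obtains w r where "w \<in> X" "strict_mono r" "(\<lambda>n. F (t (r n)) z) \<longlonglongrightarrow> w"
    "reach w z" "reach w w"
proof -
  have "\<forall>n. F (t n) z \<in> X" by (simp add: F_in[OF z])
  then have "\<exists>w\<in>X. \<exists>r. strict_mono (r :: nat \<Rightarrow> nat) \<and> ((\<lambda>n. F (t n) z) \<circ> r) \<longlonglongrightarrow> w"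
    using cpt[unfolded compact_def, THEN spec, of "\<lambda>n. F (t n) z"] by blast
  then obtain w r where w: "w \<in> X" "strict_mono (r :: nat \<Rightarrow> nat)" "(\<lambda>n. F (t (r n)) z) \<longlonglongrightarrow> w"
    by (auto simp: o_def)
  have near: "\<exists>k\<le>M. dist (F k z) w < d" if "d > 0" for d M
  proof -
    obtain n0 where n0: "\<forall>n\<ge>n0. t n \<le> M" using t by blast
    obtain n1 where n1: "\<forall>n\<ge>n1. dist (F (t (r n)) z) w < d"
      using w(3) \<open>d > 0\<close> by (meson lim_sequentially)
    have "n0 \<le> r (max n0 n1)"
      using seq_suble[OF w(2), of "max n0 n1"] by linarith
    then show ?thesis using n0 n1 by (intro exI[of _ "t (r (max n0 n1))"]) auto
  qed
  have "reach w z"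
  proof (rule reach_F_lim[OF w(1) z])
    fix d :: real assume "d > 0"
    then obtain k where "k \<le> -1" "dist (F k z) w < d" using near by blast
    then show "\<exists>u n. u \<in> X \<and> 0 < n \<and> dist u w < d \<and> dist (F n u) z < d"
      using z \<open>d > 0\<close> by (intro exI[of _ "F k z"] exI[of _ "- k"]) (auto simp: F_in simp flip: F_add)
  qed
  moreover have "reach w w"
  proof (rule reach_F_lim[OF w(1) w(1)])
    fix d :: real assume "d > 0"
    then obtain k where "dist (F k z) w < d" using near by blast
    moreover obtain l where "l \<le> k - 1" "dist (F l z) w < d"
      using near[OF \<open>d > 0\<close>] by blast
    ultimately show "\<exists>u n. u \<in> X \<and> 0 < n \<and> dist u w < d \<and> dist (F n u) w < d"
      using z by (intro exI[of _ "F l z"] exI[of _ "k - l"]) (auto simp: F_in simp flip: F_add)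
  qed
  ultimately show ?thesis using that w by blast
qed

text \<open>The orbit of \<open>z\<close> accumulates wherever that of \<open>v\<close> does, say at
  \<open>w\<close>. Since \<open>v\<close> is chain recurrent, every point of its orbit reaches
  \<open>v\<close>, and so does the limit \<open>w\<close>.\<close>

lemma fwd_asymp_reach:
  assumes "z \<in> X" "reach v v" "fwd_asymp z v"
  shows "reach z v"
proof -
  have v: "v \<in> X" using reach_in assms by blast
  have t: "\<exists>n0. \<forall>n\<ge>n0. M \<le> int n" for M by (intro exI[of _ "nat M"]) auto
  obtain w r where w: "w \<in> X" "strict_mono r" "(\<lambda>n. F (int (r n)) v) \<longlonglongrightarrow> w"
    using omega_limit[OF v t] by metis
  have "reach w v"
    by (rule reach_tendsto_left[OF _ w(3,1)]) (rule reach_F[OF assms(2)])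
  moreover have "reach z w"
  proof (rule reach_F_lim[OF assms(1) w(1)])
    fix d :: real assume "d > 0"
    then obtain M where M: "\<forall>k\<ge>M. dist (F k z) (F k v) < d / 2"
      using assms(3) unfolding fwd_asymp_def by (meson half_gt_zero)
    obtain n1 where n1: "\<forall>n\<ge>n1. dist (F (int (r n)) v) w < d / 2"
      using w(3) \<open>d > 0\<close> by (meson half_gt_zero lim_sequentially)
    define n where "n = max n1 (nat (max M 1))"
    have "n \<le> r n" by (rule seq_suble[OF w(2)])
    moreover have "M \<le> int n" "1 \<le> int n" by (auto simp: n_def)
    ultimately have "M \<le> int (r n)" "1 \<le> int (r n)" by linarith+
    then have "dist (F (int (r n)) z) w < d"
      using M n1 dist_triangle_half_l[of "F (int (r n)) z" "F (int (r n)) v" d w]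
      by (auto simp: n_def dist_commute)
    then show "\<exists>u n. u \<in> X \<and> 0 < n \<and> dist u z < d \<and> dist (F n u) w < d"
      using assms(1) \<open>d > 0\<close> \<open>1 \<le> int (r n)\<close> by (intro exI[of _ z] exI[of _ "int (r n)"]) auto
  qed
  ultimately show ?thesis using reach_trans by blast
qed

text \<open>The same argument in the past, with an accumulation point of the backward orbit of
  \<open>v\<close>.\<close>

lemma bwd_asymp_reach:
  assumes "z \<in> X" "reach v v" "bwd_asymp z v"
  shows "reach v z"
proof -
  have v: "v \<in> X" using reach_in assms by blast
  have t: "\<exists>n0. \<forall>n\<ge>n0. - int n \<le> M" for M by (intro exI[of _ "nat (- M)"]) auto
  obtain w r where w: "w \<in> X" "strict_mono r" "(\<lambda>n. F (- int (r n)) v) \<longlonglongrightarrow> w"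
    using alpha_limit[OF v t] by metis
  have "reach v w"
    by (rule reach_tendsto_right[OF _ w(3,1)]) (rule reach_F[OF assms(2)])
  moreover have "reach w z"
  proof (rule reach_F_lim[OF w(1) assms(1)])
    fix d :: real assume "d > 0"
    then obtain M where M: "\<forall>k\<le>M. dist (F k z) (F k v) < d / 2"
      using assms(3) unfolding bwd_asymp_def by (meson half_gt_zero)
    obtain n1 where n1: "\<forall>n\<ge>n1. dist (F (- int (r n)) v) w < d / 2"
      using w(3) \<open>d > 0\<close> by (meson half_gt_zero lim_sequentially)
    define n where "n = max n1 (nat (max (- M) 1))"
    have "n \<le> r n" by (rule seq_suble[OF w(2)])
    moreover have "- int n \<le> M" "1 \<le> int n" by (auto simp: n_def)
    ultimately have "- int (r n) \<le> M" "1 \<le> int (r n)" by linarith+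
    then have "dist (F (- int (r n)) z) w < d"
      using M n1 dist_triangle_half_l[of "F (- int (r n)) z" "F (- int (r n)) v" d w]
      by (auto simp: n_def dist_commute)
    then show "\<exists>u n. u \<in> X \<and> 0 < n \<and> dist u w < d \<and> dist (F n u) z < d"
      using assms(1) \<open>d > 0\<close> \<open>1 \<le> int (r n)\<close>
      by (intro exI[of _ "F (- int (r n)) z"] exI[of _ "int (r n)"]) (auto simp: F_in simp flip: F_add)
  qed
  ultimately show ?thesis using reach_trans by blast
qed

end

section \<open>Consequences of the L-shadowing property\<close>

locale L_shadowing_homeo = compact_homeo +
  assumes L: "L_shadowing X f g"
begin

subsection \<open>Pseudo orbits with exact tails\<close>

text \<open>A sequence whose two tails are true orbits has no error far out, so it satisfies the
  decay condition; the limits in \<open>L_shadowed\<close> then say that \<open>z\<close> is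
  asymptotic to these orbits.\<close>

lemma tail_shadow:
  assumes "e > 0"
  obtains d where "d > 0"
    "\<And>s n m x y. \<lbrakk>\<And>k. s k \<in> X; \<And>k. dist (f (s k)) (s (k + 1)) \<le> d; x \<in> X; y \<in> X;
       \<And>k. k < n \<Longrightarrow> s k = F k x; \<And>k. k \<ge> m \<Longrightarrow> s k = F k y\<rbrakk> \<Longrightarrow>
       \<exists>z\<in>X. (\<forall>k. dist (F k z) (s k) \<le> e) \<and> bwd_asymp z x \<and> fwd_asymp z y"
proof -
  obtain d where d: "d > 0" "\<And>s. L_pseudo_orbit X f d s \<Longrightarrow> \<exists>z\<in>X. L_shadowed f g e s z"
    using L assms unfolding L_shadowing_def by blast
  show ?thesis
  proof (rule that[OF d(1)])
    fix s n m x y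
    assume s: "\<And>k. s k \<in> X" "\<And>k. dist (f (s k)) (s (k + 1)) \<le> d" and x: "x \<in> X" and y: "y \<in> X"
      and n: "\<And>k. k < n \<Longrightarrow> s k = F k x" and m: "\<And>k. k \<ge> m \<Longrightarrow> s k = F k y"
    have "eventually (\<lambda>k. dist (f (s k)) (s (k + 1)) = 0) at_top"
      unfolding eventually_at_top_linorder
      by (rule exI[of _ m]) (simp add: m F_Suc[OF y])
    moreover have "eventually (\<lambda>k. dist (f (s k)) (s (k + 1)) = 0) at_bot"
      unfolding eventually_at_bot_linorder
      \<comment> \<open>Both \<open>k\<close> and \<open>k + 1\<close> must lie strictly below
        \<open>n\<close>.\<close>
      by (rule exI[of _ "n - 2"]) (simp add: n F_Suc[OF x])
    ultimately have "L_pseudo_orbit X f d s"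
      unfolding L_pseudo_orbit_def using s by (simp add: tendsto_eventually)
    then obtain z where z: "z \<in> X" "L_shadowed f g e s z" using d(2) by blast
    have "bwd_asymp z x"
      unfolding bwd_asymp_def
    proof (intro allI impI)
      fix r :: real assume "r > 0"
      then have "eventually (\<lambda>k. dist (F k z) (s k) < r) at_bot"
        using z(2) unfolding L_shadowed_def by (intro order_tendstoD(2)) auto
      then obtain M where M: "\<forall>k\<le>M. dist (F k z) (s k) < r"
        unfolding eventually_at_bot_linorder by blast
      show "\<exists>M. \<forall>k\<le>M. dist (F k z) (F k x) < r"
      proof (intro exI[of _ "min M (n - 1)"] allI impI)
        fix k assume "k \<le> min M (n - 1)"
        then show "dist (F k z) (F k x) < r" using M n[of k] by auto
      qed
    qed
    moreover have "fwd_asymp z y"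
      unfolding fwd_asymp_def
    proof (intro allI impI)
      fix r :: real assume "r > 0"
      then have "eventually (\<lambda>k. dist (F k z) (s k) < r) at_top"
        using z(2) unfolding L_shadowed_def by (intro order_tendstoD(2)) auto
      then obtain M where M: "\<forall>k\<ge>M. dist (F k z) (s k) < r"
        unfolding eventually_at_top_linorder by blast
      show "\<exists>M. \<forall>k\<ge>M. dist (F k z) (F k y) < r"
      proof (intro exI[of _ "max M m"] allI impI)
        fix k assume "k \<ge> max M m"
        then show "dist (F k z) (F k y) < r" using M m[of k] by auto
      qed
    qed
    ultimately show "\<exists>z\<in>X. (\<forall>k. dist (F k z) (s k) \<le> e) \<and> bwd_asymp z x \<and> fwd_asymp z y"
      using z unfolding L_shadowed_def by blast
  qed
qed

text \<open>Follow \<open>x\<close> up to time -1 and \<open>y\<close> from time 0 on; the only jump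
  has size \<open>dist x y\<close>.\<close>

lemma join:
  assumes "e > 0"
  obtains d where "d > 0"
    "\<And>x y. \<lbrakk>x \<in> X; y \<in> X; dist x y \<le> d\<rbrakk> \<Longrightarrow>
       \<exists>z\<in>X. (\<forall>k\<le>0. dist (F k z) (F k x) \<le> e) \<and> (\<forall>k\<ge>0. dist (F k z) (F k y) \<le> e) \<and>
         bwd_asymp z x \<and> fwd_asymp z y"
proof -
  obtain d where d: "d > 0"
    "\<And>s n m x y. \<lbrakk>\<And>k. s k \<in> X; \<And>k. dist (f (s k)) (s (k + 1)) \<le> d; x \<in> X; y \<in> X;
       \<And>k. k < n \<Longrightarrow> s k = F k x; \<And>k. k \<ge> m \<Longrightarrow> s k = F k y\<rbrakk> \<Longrightarrow>
       \<exists>z\<in>X. (\<forall>k. dist (F k z) (s k) \<le> e / 2) \<and> bwd_asymp z x \<and> fwd_asymp z y"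
    using tail_shadow[of "e / 2"] assms by (metis half_gt_zero)
  show ?thesis
  \<comment> \<open>At time 0 the sequence already sits at \<open>y\<close>, so closeness to
    \<open>x\<close> there costs the shadowing error plus \<open>dist x y\<close>, each at most
    \<open>e / 2\<close>.\<close>
  proof (rule that[of "min d (e / 2)"])
    fix x y assume xy: "x \<in> X" "y \<in> X" "dist x y \<le> min d (e / 2)"
    define s where "s k = (if k < 0 then F k x else F k y)" for k
    have "\<exists>z\<in>X. (\<forall>k. dist (F k z) (s k) \<le> e / 2) \<and> bwd_asymp z x \<and> fwd_asymp z y"
    proof (rule d(2)[where n = 0 and m = 0])
      show "dist (f (s k)) (s (k + 1)) \<le> d" for k
      proof (cases "k = -1")
        case True
        then show ?thesis using xy F_Suc[OF xy(1), of "- 1"] by (simp add: s_def)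
      next
        case False
        then show ?thesis using xy d(1) by (simp add: s_def F_Suc)
      qed
    qed (use xy F_in in \<open>auto simp: s_def\<close>)
    then obtain z where z: "z \<in> X" "\<And>k. dist (F k z) (s k) \<le> e / 2" "bwd_asymp z x" "fwd_asymp z y"
      by blast
    have "dist (F k z) (F k y) \<le> e" if "k \<ge> 0" for k
      using z(2)[of k] that assms by (simp add: s_def)
    moreover have "dist (F k z) (F k x) \<le> e" if "k \<le> 0" for k
    proof (cases "k = 0")
      case True
      then show ?thesis using z(2)[of 0] xy dist_triangle[of z x y]
        by (simp add: s_def dist_commute)
    next
      case False
      then show ?thesis using z(2)[of k] that assms by (simp add: s_def)
    qed
    ultimately show "\<exists>z\<in>X. (\<forall>k\<le>0. dist (F k z) (F k x) \<le> e) \<and>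
        (\<forall>k\<ge>0. dist (F k z) (F k y) \<le> e) \<and> bwd_asymp z x \<and> fwd_asymp z y"
      using z by blast
  qed (use d assms in auto)
qed

text \<open>Keeping the pseudo orbit only on \<open>[-n, n]\<close> and continuing by true orbits
  makes \<open>tail_shadow\<close> applicable with a \<open>d\<close> independent of
  \<open>n\<close>. A limit of the shadowing points works on all windows; using \<open>e / 2\<close>
  restores the strict inequality after the limit.\<close>

lemma shadowing: "shadowing X f g"
  unfolding shadowing_def
proof (intro allI impI)
  fix e :: real assume e: "e > 0"
  obtain d where d: "d > 0"
    "\<And>s n m x y. \<lbrakk>\<And>k. s k \<in> X; \<And>k. dist (f (s k)) (s (k + 1)) \<le> d; x \<in> X; y \<in> X;
       \<And>k. k < n \<Longrightarrow> s k = F k x; \<And>k. k \<ge> m \<Longrightarrow> s k = F k y\<rbrakk> \<Longrightarrow>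
       \<exists>z\<in>X. (\<forall>k. dist (F k z) (s k) \<le> e / 2) \<and> bwd_asymp z x \<and> fwd_asymp z y"
    using tail_shadow[of "e / 2"] e by (metis half_gt_zero)
  have "\<exists>y\<in>X. \<forall>k. dist (F k y) (x k) < e"
    if x: "\<forall>k. x k \<in> X" "\<forall>k. dist (f (x k)) (x (k + 1)) < d" for x :: "int \<Rightarrow> 'a"
  proof -
    have "\<exists>z\<in>X. \<forall>k. \<bar>k\<bar> \<le> int n \<longrightarrow> dist (F k z) (x k) \<le> e / 2" for n
    proof -
      \<comment> \<open>The orbits of \<open>u\<close> and \<open>v\<close> pass through
        \<open>x (- int n)\<close> and \<open>x (int n)\<close> at exactly these times, so the tails
        attach without error.\<close>
      define u where "u = F (int n) (x (- int n))"
      define v where "v = F (- int n) (x (int n))"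
      have uv: "u \<in> X" "v \<in> X" using x F_in by (auto simp: u_def v_def)
      have ue: "F (- int n) u = x (- int n)" and ve: "F (int n) v = x (int n)"
        using x by (simp_all add: u_def v_def flip: F_add)
      define s where "s k = (if k < - int n then F k u else if k < int n then x k else F k v)" for k
      have s1: "s k = x k" if "\<bar>k\<bar> \<le> int n" for k
        using that ve by (auto simp: s_def)
      have "\<exists>z\<in>X. (\<forall>k. dist (F k z) (s k) \<le> e / 2) \<and> bwd_asymp z u \<and> fwd_asymp z v"
      proof (rule d(2)[where n = "- int n" and m = "int n"])
        show "dist (f (s k)) (s (k + 1)) \<le> d" for k
        proof -
          consider "k < - int n" | "k \<ge> int n" | "\<bar>k\<bar> \<le> int n" "\<bar>k + 1\<bar> \<le> int n" by linarith
          then show ?thesis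
          proof cases
            case 1
            have "s (k + 1) = F (k + 1) u"
            proof (cases "k + 1 = - int n")
              case True
              then show ?thesis using s1[of "k + 1"] ue by simp
            qed (use 1 in \<open>simp add: s_def\<close>)
            then show ?thesis using 1 d(1) by (simp add: s_def F_Suc[OF uv(1)])
          next
            case 2
            then show ?thesis using d(1) by (simp add: s_def F_Suc[OF uv(2)])
          next
            case 3
            then show ?thesis using x(2) by (simp add: s1 less_imp_le)
          qed
        qed
      qed (use uv x F_in in \<open>auto simp: s_def\<close>)
      then obtain z where z: "z \<in> X" "\<And>k. dist (F k z) (s k) \<le> e / 2" by blast
      have "dist (F k z) (x k) \<le> e / 2" if "\<bar>k\<bar> \<le> int n" for k
        using z(2)[of k] s1[OF that] by simp
      then show ?thesis using z(1) by blast
    qed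
    then have "\<forall>n. \<exists>z. z \<in> X \<and> (\<forall>k. \<bar>k\<bar> \<le> int n \<longrightarrow> dist (F k z) (x k) \<le> e / 2)" by blast
    from choice[OF this] obtain z where z: "\<And>n. z n \<in> X"
      "\<And>n k. \<bar>k\<bar> \<le> int n \<Longrightarrow> dist (F k (z n)) (x k) \<le> e / 2" by blast
    have "\<exists>w\<in>X. \<exists>r. strict_mono (r :: nat \<Rightarrow> nat) \<and> (z \<circ> r) \<longlonglongrightarrow> w"
      using cpt[unfolded compact_def, THEN spec, of z] z(1) by simp
    then obtain w r where w: "w \<in> X" "strict_mono (r :: nat \<Rightarrow> nat)" "(z \<circ> r) \<longlonglongrightarrow> w"
      by blast
    have "dist (F k w) (x k) < e" for k
    proof -
      have "(\<lambda>n. F k ((z \<circ> r) n)) \<longlonglongrightarrow> F k w"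
        by (rule F_tendsto) (use w(1,3) z(1) in \<open>simp_all add: o_def\<close>)
      then have lim: "(\<lambda>n. dist (F k ((z \<circ> r) n)) (x k)) \<longlonglongrightarrow> dist (F k w) (x k)"
        by (intro tendsto_dist tendsto_const)
      have "dist (F k ((z \<circ> r) n)) (x k) \<le> e / 2" if "n \<ge> nat \<bar>k\<bar>" for n
      proof -
        have "n \<le> r n" by (rule seq_suble[OF w(2)])
        then have "\<bar>k\<bar> \<le> int (r n)" using that by linarith
        then show ?thesis using z(2) by simp
      qed
      then have "dist (F k w) (x k) \<le> e / 2"
        by (intro LIMSEQ_le_const2[OF lim]) blast
      then show ?thesis using e by linarith
    qed
    then show ?thesis using w by blast
  qed
  then show "\<exists>\<delta>>0. \<forall>x. (\<forall>k. x k \<in> X) \<and> (\<forall>k. dist (f (x k)) (x (k + 1)) < \<delta>) \<longrightarrow>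
      (\<exists>y\<in>X. \<forall>k. dist (F k y) (x k) < e)"
    using d(1) by blast
qed

subsection \<open>Finiteness of the chain recurrent classes\<close>

text \<open>The joining point is backward asymptotic to \<open>x\<close>, hence reached from it, and
  forward asymptotic to \<open>y\<close>, hence reaches it. Any shadowing size would do in place of
  1.\<close>

lemma close_reach:
  obtains d where "d > 0" "\<And>x y. reach x x \<Longrightarrow> reach y y \<Longrightarrow> dist x y \<le> d \<Longrightarrow> reach x y"
proof -
  obtain d where d: "d > 0" "\<And>x y. \<lbrakk>x \<in> X; y \<in> X; dist x y \<le> d\<rbrakk> \<Longrightarrow>
       \<exists>z\<in>X. (\<forall>k\<le>0. dist (F k z) (F k x) \<le> 1) \<and> (\<forall>k\<ge>0. dist (F k z) (F k y) \<le> 1) \<and>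
         bwd_asymp z x \<and> fwd_asymp z y"
    using join[of 1] by (metis zero_less_one)
  show ?thesis
  proof (rule that[OF d(1)])
    fix x y assume xy: "reach x x" "reach y y" "dist x y \<le> d"
    then obtain z where "z \<in> X" "bwd_asymp z x" "fwd_asymp z y" using d(2) reach_in by meson
    then show "reach x y" using bwd_asymp_reach fwd_asymp_reach xy reach_trans by blast
  qed
qed

lemma finite_chain_classes: "finite (chain_classes X f)"
proof -
  obtain d where d: "d > 0" "\<And>x y. reach x x \<Longrightarrow> reach y y \<Longrightarrow> dist x y \<le> d \<Longrightarrow> reach x y"
    using close_reach by blast
  obtain C where C: "finite C" "X \<subseteq> (\<Union>c\<in>C. ball c (d / 2))"
    using compact_eq_totally_bounded[of X] cpt d(1) by (meson half_gt_zero)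
  \<comment> \<open>For a ball without chain recurrent points this is an arbitrary value; it is
    evaluated only at balls that contain one.\<close>
  define rep where "rep c = (SOME x. reach x x \<and> dist c x < d / 2)" for c
  have "chain_classes X f \<subseteq> (\<lambda>c. chain_class X f (rep c)) ` C"
  proof
    fix A assume "A \<in> chain_classes X f"
    then obtain x where x: "x \<in> X" "reach x x" "A = chain_class X f x"
      unfolding chain_classes_def chain_class_eq by blast
    then obtain c where c: "c \<in> C" "dist c x < d / 2" using C by auto
    then have r: "reach (rep c) (rep c)" "dist c (rep c) < d / 2"
      using someI[of "\<lambda>x. reach x x \<and> dist c x < d / 2" x] x by (auto simp: rep_def)
    have "dist x (rep c) \<le> d"
      using c r dist_triangle_half_r[of c x d "rep c"] by simp
    then have "reach x (rep c)" "reach (rep c) x"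
      using d(2) x r by (auto simp: dist_commute)
    then have "reach x y \<longleftrightarrow> reach (rep c) y" "reach y x \<longleftrightarrow> reach y (rep c)" for y
      by (meson reach_trans)+
    then have "A = chain_class X f (rep c)"
      using x(3) by (simp add: chain_class_eq)
    then show "A \<in> (\<lambda>c. chain_class X f (rep c)) ` C" using c by blast
  qed
  then show ?thesis using C(1) finite_surj by blast
qed

subsection \<open>Bi-asymptotic pairs\<close>

text \<open>Here \<open>a\<close> switches from the orbit of \<open>x\<close> to that of
  \<open>w\<close>, and \<open>b\<close> from that of \<open>z\<close> to that of \<open>q\<close>.
  In the past both follow \<open>x\<close>, because \<open>z\<close> does; in the future both follow
  \<open>q\<close>, because \<open>w\<close> does. The separation of \<open>p\<close> and
  \<open>q\<close> in the past keeps \<open>a\<close> and \<open>b\<close> apart at the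
  switch.\<close>

lemma link_pairs:
  assumes e: "e > 0"
  obtains c where "c > 0"
    "\<And>x y p q r M0. \<lbrakk>reach x x; y \<in> X; p \<in> X; reach q q;
       \<And>k. dist (F k x) (F k y) \<le> c; \<And>k. dist (F k p) (F k q) \<le> c;
       r > 0; \<And>k. k \<le> M0 \<Longrightarrow> r \<le> dist (F k p) (F k q);
       \<And>t M. t > 0 \<Longrightarrow> \<exists>m\<ge>M. \<exists>n\<le>- M. dist (F m x) (F n p) < t \<and> dist (F m y) (F n q) < t\<rbrakk> \<Longrightarrow>
       \<exists>a\<in>X. \<exists>b\<in>X. a \<noteq> b \<and> reach x a \<and> reach a q \<and> bwd_asymp a b \<and> fwd_asymp a b \<and>
         (\<forall>k. dist (F k a) (F k b) \<le> 4 * e)"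
proof -
  obtain c where c: "c > 0" and jc:
    "\<And>x y. \<lbrakk>x \<in> X; y \<in> X; dist x y \<le> c\<rbrakk> \<Longrightarrow>
       \<exists>z\<in>X. (\<forall>k\<le>0. dist (F k z) (F k x) \<le> e) \<and> (\<forall>k\<ge>0. dist (F k z) (F k y) \<le> e) \<and>
         bwd_asymp z x \<and> fwd_asymp z y"
    using join[OF e] by metis
  show ?thesis
  proof (rule that[of "min c e"])
    fix x y p q :: 'a and r :: real and M0 :: int
    assume rx: "reach x x" and y: "y \<in> X" and p: "p \<in> X" and rq: "reach q q"
      and xy: "\<And>k. dist (F k x) (F k y) \<le> min c e"
      and pq: "\<And>k. dist (F k p) (F k q) \<le> min c e"
      and r: "r > 0" and sep: "\<And>k. k \<le> M0 \<Longrightarrow> r \<le> dist (F k p) (F k q)"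
      and near: "\<And>t M. t > 0 \<Longrightarrow>
        \<exists>m\<ge>M. \<exists>n\<le>- M. dist (F m x) (F n p) < t \<and> dist (F m y) (F n q) < t"
    have x: "x \<in> X" and q: "q \<in> X" using rx rq reach_in by auto
    obtain z where z: "z \<in> X" "\<And>k. k \<le> 0 \<Longrightarrow> dist (F k z) (F k x) \<le> e"
      "\<And>k. k \<ge> 0 \<Longrightarrow> dist (F k z) (F k y) \<le> e" "bwd_asymp z x" "fwd_asymp z y"
      using jc[OF x y] xy[of 0] by auto
    obtain w where w: "w \<in> X" "\<And>k. k \<le> 0 \<Longrightarrow> dist (F k w) (F k p) \<le> e"
      "\<And>k. k \<ge> 0 \<Longrightarrow> dist (F k w) (F k q) \<le> e" "bwd_asymp w p" "fwd_asymp w q"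
      using jc[OF p q] pq[of 0] by auto
    have xz: "dist (F k x) (F k z) \<le> 2 * e" for k
    proof (cases "k \<le> 0")
      case True
      then show ?thesis using z(2)[of k] e by (simp add: dist_commute)
    next
      case False
      then show ?thesis
        using z(3)[of k] xy[of k] dist_triangle2[of "F k x" "F k z" "F k y"] by simp
    qed
    have wq: "dist (F k w) (F k q) \<le> 2 * e" for k
    proof (cases "k \<ge> 0")
      case True
      then show ?thesis using w(3)[of k] e by simp
    next
      case False
      then show ?thesis
        using w(2)[of k] pq[of k] dist_triangle[of "F k w" "F k q" "F k p"] by simp
    qed
    \<comment> \<open>If \<open>a = b\<close>, the errors at the switch would give \<open>r\<close>
      at most \<open>t + 2 * h\<close>, hence at most \<open>3 * h\<close>; the factor 1/8 excludes
      this.\<close>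
    define h where "h = min e (r / 8)"
    have h: "h > 0" "h \<le> e" "h \<le> r / 8" using e r by (auto simp: h_def)
    obtain d where d: "d > 0" and jd:
      "\<And>x y. \<lbrakk>x \<in> X; y \<in> X; dist x y \<le> d\<rbrakk> \<Longrightarrow>
         \<exists>z\<in>X. (\<forall>k\<le>0. dist (F k z) (F k x) \<le> h) \<and> (\<forall>k\<ge>0. dist (F k z) (F k y) \<le> h) \<and>
           bwd_asymp z x \<and> fwd_asymp z y"
      using join[OF h(1)] by metis
    define t where "t = min d h / 2"
    have t: "t > 0" "2 * t \<le> d" "t \<le> h" using d h by (auto simp: t_def)
    obtain M1 where M1: "\<And>k. k \<ge> M1 \<Longrightarrow> dist (F k z) (F k y) < t"
      using z(5) t(1) unfolding fwd_asymp_def by blast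
    obtain M2 where M2: "\<And>k. k \<le> M2 \<Longrightarrow> dist (F k w) (F k p) < t"
      using w(4) t(1) unfolding bwd_asymp_def by blast
    \<comment> \<open>Beyond \<open>M\<close>, \<open>z\<close> has settled on \<open>y\<close>;
      before \<open>- M\<close>, \<open>w\<close> is still close to \<open>p\<close>, and
      \<open>p\<close>, \<open>q\<close> are separated.\<close>
    define M where "M = max M1 (max (- M2) (- M0))"
    obtain m n where mn: "m \<ge> M" "n \<le> - M" "dist (F m x) (F n p) < t" "dist (F m y) (F n q) < t"
      using near[OF t(1), of M] by blast
    have zm: "dist (F m z) (F m y) < t" using M1 mn by (simp add: M_def)
    have wn: "dist (F n w) (F n p) < t" using M2 mn by (simp add: M_def)
    have pqn: "r \<le> dist (F n p) (F n q)" using sep mn by (simp add: M_def)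
    have inX: "F m x \<in> X" "F n w \<in> X" "F m z \<in> X" "F n q \<in> X"
      using x w z q by (simp_all add: F_in)
    have "dist (F m x) (F n w) \<le> d"
      using mn(3) wn t dist_triangle2[of "F m x" "F n w" "F n p"] by linarith
    from jd[OF inX(1,2) this] obtain a where a: "a \<in> X"
      "\<And>k. k \<le> 0 \<Longrightarrow> dist (F k a) (F k (F m x)) \<le> h"
      "\<And>k. k \<ge> 0 \<Longrightarrow> dist (F k a) (F k (F n w)) \<le> h" "bwd_asymp a (F m x)" "fwd_asymp a (F n w)"
      by blast
    have "dist (F m z) (F n q) \<le> d"
      using mn(4) zm t dist_triangle[of "F m z" "F n q" "F m y"] by linarith
    from jd[OF inX(3,4) this] obtain b where b: "b \<in> X"
      "\<And>k. k \<le> 0 \<Longrightarrow> dist (F k b) (F k (F m z)) \<le> h"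
      "\<And>k. k \<ge> 0 \<Longrightarrow> dist (F k b) (F k (F n q)) \<le> h" "bwd_asymp b (F m z)" "fwd_asymp b (F n q)"
      by blast
    have aq: "fwd_asymp a (F n q)"
      using a(5) fwd_asymp_shift[OF w(1) q w(5)] by (rule fwd_asymp_trans)
    have fab: "fwd_asymp a b" using aq b(5) fwd_asymp_sym fwd_asymp_trans by blast
    have "bwd_asymp b (F m x)"
      using b(4) bwd_asymp_shift[OF z(1) x z(4)] by (rule bwd_asymp_trans)
    then have pab: "bwd_asymp a b" using a(4) bwd_asymp_sym bwd_asymp_trans by blast
    have "reach (F m x) (F m x)" "reach (F n q) (F n q)"
      using reach_F[OF rx, of m] reach_F[OF rq, of n] reach_trans by blast+
    then have "reach (F m x) a" "reach a (F n q)"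
      using bwd_asymp_reach[OF a(1)] fwd_asymp_reach[OF a(1)] a(4) aq by blast+
    then have ra: "reach x a" "reach a q"
      using reach_F[OF rx, of m] reach_F[OF rq, of n] reach_trans by blast+
    have "a \<noteq> b"
    proof
      assume "a = b"
      then have "dist (F n w) (F n q) \<le> 2 * h"
        using a(3)[of 0] b(3)[of 0] dist_triangle3[of "F n w" "F n q" a] by simp
      then have "r \<le> t + 2 * h"
        using pqn wn dist_triangle3[of "F n p" "F n q" "F n w"] by linarith
      then show False using t h r by linarith
    qed
    \<comment> \<open>Two shadowing errors of at most \<open>e\<close> are added to the bound
      \<open>2 * e\<close> for the pair being followed.\<close>
    moreover have "dist (F k a) (F k b) \<le> 4 * e" for k
    proof (cases "k \<le> 0")
      case True
      have "dist (F k (F m x)) (F k (F m z)) \<le> 2 * e"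
        using xz[of "k + m"] x z by (simp add: F_add)
      then show ?thesis
        using a(2)[OF True] b(2)[OF True] h(2)
          dist_triangle[of "F k a" "F k b" "F k (F m x)"]
          dist_triangle2[of "F k (F m x)" "F k b" "F k (F m z)"] by linarith
    next
      case False
      then have k: "k \<ge> 0" by simp
      have "dist (F k (F n w)) (F k (F n q)) \<le> 2 * e"
        using wq[of "k + n"] w q by (simp add: F_add)
      then show ?thesis
        using a(3)[OF k] b(3)[OF k] h(2)
          dist_triangle[of "F k a" "F k b" "F k (F n w)"]
          dist_triangle2[of "F k (F n w)" "F k b" "F k (F n q)"] by linarith
    qed
    ultimately show "\<exists>a\<in>X. \<exists>b\<in>X. a \<noteq> b \<and> reach x a \<and> reach a q \<and> bwd_asymp a b \<and> fwd_asymp a b \<and>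
        (\<forall>k. dist (F k a) (F k b) \<le> 4 * e)"
      using a(1) b(1) ra pab fab by blast
  qed (use c e in simp)
qed

text \<open>One subsequence has to serve both orbits, hence compactness of the product; continuity
  of each \<open>F k\<close> carries the limit to all shifts.\<close>

lemma pair_limit:
  fixes t :: "nat \<Rightarrow> int"
  assumes x: "x \<in> X" and y: "y \<in> X"
  obtains p q s where "p \<in> X" "q \<in> X" "strict_mono (s :: nat \<Rightarrow> nat)"
    "\<And>k. (\<lambda>n. F (k + t (s n)) x) \<longlonglongrightarrow> F k p" "\<And>k. (\<lambda>n. F (k + t (s n)) y) \<longlonglongrightarrow> F k q"
proof -
  define u where "u n = (F (t n) x, F (t n) y)" for n
  have "u n \<in> X \<times> X" for n using x y by (simp add: u_def F_in)
  then have "\<exists>l\<in>X \<times> X. \<exists>r. strict_mono (r :: nat \<Rightarrow> nat) \<and> (u \<circ> r) \<longlonglongrightarrow> l"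
    using compact_Times[OF cpt cpt, unfolded compact_def, THEN spec, of u] by simp
  then obtain p q s where pq: "p \<in> X" "q \<in> X" "strict_mono (s :: nat \<Rightarrow> nat)" "(u \<circ> s) \<longlonglongrightarrow> (p, q)"
    by blast
  have "(\<lambda>n. F (t (s n)) x) \<longlonglongrightarrow> p" "(\<lambda>n. F (t (s n)) y) \<longlonglongrightarrow> q"
    using tendsto_fst[OF pq(4)] tendsto_snd[OF pq(4)] by (simp_all add: u_def o_def)
  then have "(\<lambda>n. F k (F (t (s n)) x)) \<longlonglongrightarrow> F k p" "(\<lambda>n. F k (F (t (s n)) y)) \<longlonglongrightarrow> F k q" for k
    using F_tendsto pq(1,2) x y F_in by meson+
  then show ?thesis using that[OF pq(1-3)] x y by (simp add: F_add)
qed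

lemma homoclinic_pair:
  assumes nexp: "\<not> expansive_set f g (chain_class X f x0)" and e: "e > 0"
  obtains a b where "a \<in> chain_class X f x0" "b \<in> X" "a \<noteq> b" "bwd_asymp a b" "fwd_asymp a b"
    "\<And>k. dist (F k a) (F k b) \<le> 4 * e"
proof -
  obtain c where c: "c > 0" and lc:
    "\<And>x y p q r M0. \<lbrakk>reach x x; y \<in> X; p \<in> X; reach q q;
       \<And>k. dist (F k x) (F k y) \<le> c; \<And>k. dist (F k p) (F k q) \<le> c;
       r > 0; \<And>k. k \<le> M0 \<Longrightarrow> r \<le> dist (F k p) (F k q);
       \<And>t M. t > 0 \<Longrightarrow> \<exists>m\<ge>M. \<exists>n\<le>- M. dist (F m x) (F n p) < t \<and> dist (F m y) (F n q) < t\<rbrakk> \<Longrightarrow>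
       \<exists>a\<in>X. \<exists>b\<in>X. a \<noteq> b \<and> reach x a \<and> reach a q \<and> bwd_asymp a b \<and> fwd_asymp a b \<and>
         (\<forall>k. dist (F k a) (F k b) \<le> 4 * e)"
    using link_pairs[OF e] by metis
  obtain x y where xy: "x \<in> chain_class X f x0" "y \<in> chain_class X f x0" "x \<noteq> y"
    "\<And>k. dist (F k x) (F k y) \<le> min c e"
    using nexp c e unfolding expansive_set_def by (metis min_less_iff_conj not_less)
  have x: "x \<in> X" "reach x0 x" "reach x x0" and y: "y \<in> X" "reach x0 y" "reach y x0"
    using xy by (auto simp: chain_class_eq)
  have rx: "reach x x" and ry: "reach y y" using x y reach_trans by blast+
  have dc: "dist (F k x) (F k y) \<le> c" for k using xy(4)[of k] by simp
  \<comment> \<open>Either the orbits come arbitrarily close in both time directions, or they stay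
    \<open>r\<close> apart from some time on in one of them.\<close>
  consider (both) "\<And>r M. r > 0 \<Longrightarrow> \<exists>k\<ge>M. dist (F k x) (F k y) < r"
      "\<And>r M. r > 0 \<Longrightarrow> \<exists>k\<le>M. dist (F k x) (F k y) < r"
    | (future) r M where "r > 0" "\<And>k. k \<ge> M \<Longrightarrow> r \<le> dist (F k x) (F k y)"
    | (past) r M where "r > 0" "\<And>k. k \<le> M \<Longrightarrow> r \<le> dist (F k x) (F k y)"
    by (metis not_less)
  then show ?thesis
  proof cases
    case both
    define h where "h = min e (dist x y / 2)"
    have h: "h > 0" "h \<le> e" "h < dist x y" using e xy(3) by (auto simp: h_def min_less_iff_disj)
    obtain d where d: "d > 0" and td:
      "\<And>s n m x y. \<lbrakk>\<And>k. s k \<in> X; \<And>k. dist (f (s k)) (s (k + 1)) \<le> d; x \<in> X; y \<in> X;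
         \<And>k. k < n \<Longrightarrow> s k = F k x; \<And>k. k \<ge> m \<Longrightarrow> s k = F k y\<rbrakk> \<Longrightarrow>
         \<exists>z\<in>X. (\<forall>k. dist (F k z) (s k) \<le> h) \<and> bwd_asymp z x \<and> fwd_asymp z y"
      using tail_shadow[OF h(1)] by metis
    obtain m where m: "m \<ge> 1" "dist (F m x) (F m y) < d" using both(1)[OF d] by blast
    obtain n where n: "n \<le> 0" "dist (F n x) (F n y) < d" using both(2)[OF d] by blast
    \<comment> \<open>The excursion along \<open>y\<close> covers time 0, as
      \<open>n \<le> 0 < m\<close>. Since \<open>h < dist x y\<close>, the shadowing point cannot be
      \<open>x\<close>.\<close>
    define s where "s k = (if n \<le> k \<and> k < m then F k y else F k x)" for k
    have "\<exists>z\<in>X. (\<forall>k. dist (F k z) (s k) \<le> h) \<and> bwd_asymp z x \<and> fwd_asymp z x"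
    proof (rule td[where n = n and m = m])
      show "dist (f (s k)) (s (k + 1)) \<le> d" for k
      proof -
        have "f (s k) = (if n \<le> k \<and> k < m then F (k + 1) y else F (k + 1) x)"
          using F_Suc[OF x(1), of k] F_Suc[OF y(1), of k] by (simp add: s_def)
        moreover have "k + 1 = n \<or> k + 1 = m \<or> (n \<le> k \<and> k < m \<longleftrightarrow> n \<le> k + 1 \<and> k + 1 < m)"
          using n m by linarith
        ultimately show ?thesis using m n d by (auto simp: s_def dist_commute)
      qed
    qed (use x y F_in in \<open>auto simp: s_def\<close>)
    then obtain z where z: "z \<in> X" "\<And>k. dist (F k z) (s k) \<le> h" "bwd_asymp z x" "fwd_asymp z x" by blast
    have "x \<noteq> z" using z(2)[of 0] h(3) n m by (auto simp: s_def)
    moreover have "dist (F k x) (F k z) \<le> 4 * e" for k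
      using z(2)[of k] xy(4)[of k] h(2) e dist_triangle2[of "F k x" "F k z" "F k y"]
      by (auto simp: s_def dist_commute split: if_splits)
    ultimately show ?thesis
      using that[OF xy(1) z(1)] z(3,4) bwd_asymp_sym fwd_asymp_sym by blast
  next
    case future
    obtain p q s where pq: "p \<in> X" "q \<in> X" "strict_mono (s :: nat \<Rightarrow> nat)"
      and lp: "\<And>k. (\<lambda>n. F (k + int (s n)) x) \<longlonglongrightarrow> F k p"
      and lq: "\<And>k. (\<lambda>n. F (k + int (s n)) y) \<longlonglongrightarrow> F k q"
      using pair_limit[OF x(1) y(1), of int] by metis
    have s: "n \<le> s n" for n by (rule seq_suble[OF pq(3)])
    have lim: "(\<lambda>n. dist (F (k + int (s n)) x) (F (k + int (s n)) y)) \<longlonglongrightarrow> dist (F k p) (F k q)" for k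
      by (intro tendsto_dist lp lq)
    have up: "dist (F k p) (F k q) \<le> c" for k
      by (rule LIMSEQ_le_const2[OF lim]) (use dc in blast)
    \<comment> \<open>The shifts push every fixed time \<open>k\<close> past \<open>M\<close>, so
      the limit pair is separated at all times, in particular in the past.\<close>
    have low: "r \<le> dist (F k p) (F k q)" for k
    proof (rule LIMSEQ_le_const[OF lim], intro exI allI impI)
      fix n assume "n \<ge> nat (M - k)"
      then have "k + int (s n) \<ge> M" using s[of n] by linarith
      then show "r \<le> dist (F (k + int (s n)) x) (F (k + int (s n)) y)" by (rule future(2))
    qed
    have "reach q y" "reach y q"
      using reach_tendsto_left[OF _ lq[of 0]] reach_tendsto_right[OF _ lq[of 0]] reach_F[OF ry] pq(2)
      by simp_all
    then have rq: "reach q q" "reach q x0" using y reach_trans by blast+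
    have "\<exists>a\<in>X. \<exists>b\<in>X. a \<noteq> b \<and> reach x a \<and> reach a q \<and> bwd_asymp a b \<and> fwd_asymp a b \<and>
         (\<forall>k. dist (F k a) (F k b) \<le> 4 * e)"
    proof (rule lc[OF rx y(1) pq(1) rq(1) dc up future(1) low])
      fix t :: real and M' :: int assume t: "t > 0"
      define n where "n = - \<bar>M'\<bar>"
      obtain j1 where j1: "\<forall>j\<ge>j1. dist (F (n + int (s j)) x) (F n p) < t"
        using lp[of n] t unfolding lim_sequentially by blast
      obtain j2 where j2: "\<forall>j\<ge>j2. dist (F (n + int (s j)) y) (F n q) < t"
        using lq[of n] t unfolding lim_sequentially by blast
      \<comment> \<open>The term \<open>2 * \<bar>M'\<bar>\<close> compensates the shift
        \<open>n = - \<bar>M'\<bar>\<close>: the time \<open>n + int (s j)\<close> is still at least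
        \<open>M'\<close>.\<close>
      define j where "j = max (max j1 j2) (nat (2 * \<bar>M'\<bar>))"
      have "j1 \<le> j" "j2 \<le> j" by (simp_all add: j_def)
      note j1' = j1[rule_format, OF this(1)] and j2' = j2[rule_format, OF this(2)]
      have "nat (2 * \<bar>M'\<bar>) \<le> j" by (simp add: j_def)
      then have "n + int (s j) \<ge> M'" using s[of j] unfolding n_def by linarith
      moreover have "n \<le> - M'" by (simp add: n_def)
      ultimately show "\<exists>m\<ge>M'. \<exists>n\<le>- M'. dist (F m x) (F n p) < t \<and> dist (F m y) (F n q) < t"
        using j1' j2' by blast
    qed
    then obtain a b where ab: "a \<in> X" "b \<in> X" "a \<noteq> b" "reach x a" "reach a q" "bwd_asymp a b" "fwd_asymp a b"
         "\<forall>k. dist (F k a) (F k b) \<le> 4 * e" by blast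
    have "a \<in> chain_class X f x0"
      using ab x(2) rq(2) reach_trans unfolding chain_class_eq by blast
    then show ?thesis using that ab by blast
  next
    case past
    obtain p q s where pq: "p \<in> X" "q \<in> X" "strict_mono (s :: nat \<Rightarrow> nat)"
      and lp: "\<And>k. (\<lambda>n. F (k + - int (s n)) x) \<longlonglongrightarrow> F k p"
      and lq: "\<And>k. (\<lambda>n. F (k + - int (s n)) y) \<longlonglongrightarrow> F k q"
      using pair_limit[OF x(1) y(1), of "\<lambda>n. - int n"] by metis
    have s: "n \<le> s n" for n by (rule seq_suble[OF pq(3)])
    have lim: "(\<lambda>n. dist (F (k + - int (s n)) x) (F (k + - int (s n)) y)) \<longlonglongrightarrow> dist (F k p) (F k q)" for k
      by (intro tendsto_dist lp lq)
    have up: "dist (F k p) (F k q) \<le> c" for k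
      by (rule LIMSEQ_le_const2[OF lim]) (use dc in blast)
    have "reach p x" "reach x p"
      using reach_tendsto_left[OF _ lp[of 0]] reach_tendsto_right[OF _ lp[of 0]] reach_F[OF rx] pq(1)
      by simp_all
    then have rp: "reach p p" "reach x0 p" using x reach_trans by blast+
    have "\<exists>a\<in>X. \<exists>b\<in>X. a \<noteq> b \<and> reach p a \<and> reach a y \<and> bwd_asymp a b \<and> fwd_asymp a b \<and>
         (\<forall>k. dist (F k a) (F k b) \<le> 4 * e)"
    \<comment> \<open>The roles are exchanged: the limit pair comes first and \<open>(x, y)\<close>,
      which is separated in the past, second.\<close>
    proof (rule lc[OF rp(1) pq(2) x(1) ry up dc past])
      fix t :: real and M' :: int assume t: "t > 0"
      define m where "m = \<bar>M'\<bar>"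
      obtain j1 where j1: "\<forall>j\<ge>j1. dist (F m p) (F (m + - int (s j)) x) < t"
        using lp[of m] t unfolding lim_sequentially dist_commute[of "F m p"] by blast
      obtain j2 where j2: "\<forall>j\<ge>j2. dist (F m q) (F (m + - int (s j)) y) < t"
        using lq[of m] t unfolding lim_sequentially dist_commute[of "F m q"] by blast
      define j where "j = max (max j1 j2) (nat (2 * \<bar>M'\<bar>))"
      have "j1 \<le> j" "j2 \<le> j" by (simp_all add: j_def)
      note j1' = j1[rule_format, OF this(1)] and j2' = j2[rule_format, OF this(2)]
      have "nat (2 * \<bar>M'\<bar>) \<le> j" by (simp add: j_def)
      then have "m + - int (s j) \<le> - M'" using s[of j] unfolding m_def by linarith
      moreover have "m \<ge> M'" by (simp add: m_def)
      ultimately show "\<exists>m\<ge>M'. \<exists>n\<le>- M'. dist (F m p) (F n x) < t \<and> dist (F m q) (F n y) < t"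
        using j1' j2' by blast
    qed
    then obtain a b where ab: "a \<in> X" "b \<in> X" "a \<noteq> b" "reach p a" "reach a y" "bwd_asymp a b" "fwd_asymp a b"
         "\<forall>k. dist (F k a) (F k b) \<le> 4 * e" by blast
    have "a \<in> chain_class X f x0"
      using ab y(3) rp(2) reach_trans unfolding chain_class_eq by blast
    then show ?thesis using that ab by blast
  qed
qed

subsection \<open>Semi-horseshoes\<close>

lemma diameter_le_dist:
  assumes "0 \<le> r" "\<And>x y. x \<in> S \<Longrightarrow> y \<in> S \<Longrightarrow> dist x y \<le> r"
  shows "diameter S \<le> r"
  using assms by (auto simp: diameter_def intro: cSUP_least)

text \<open>The last two conclusions, returns close to \<open>a\<close> at arbitrarily late and
  early times, serve to locate \<open>K\<close> in the chain recurrent class.\<close>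

lemma horseshoe:
  assumes ra: "reach a a" and b: "b \<in> X" "a \<noteq> b" "bwd_asymp a b" "fwd_asymp a b" and e: "e > 0"
    and ab: "\<And>k. dist (F k a) (F k b) \<le> e"
  obtains N K where "1 \<le> N" "K \<subseteq> X" "compact K" "(f ^^ N) ` K = K"
    "\<And>k. diameter (F k ` K) \<le> 3 * e" "semiconj_full_shift K (f ^^ N)"
    "\<And>z M. z \<in> K \<Longrightarrow> \<exists>k\<ge>M. dist (F k z) a \<le> 2 * e"
    "\<And>z M. z \<in> K \<Longrightarrow> \<exists>k\<le>M. dist (F k z) a \<le> 2 * e"
proof -
  have a: "a \<in> X" using ra reach_in by blast
  \<comment> \<open>The bound \<open>2 * h < dist a b\<close> makes the closed
    \<open>h\<close>-balls around \<open>a\<close> and \<open>b\<close> disjoint, so the symbols can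
    be read off.\<close>
  define h where "h = min e (dist a b / 3)"
  have h: "h > 0" "h \<le> e" "2 * h < dist a b" using e b(2) by (auto simp: h_def min_def)
  obtain d where d: "d > 0" and sh: "\<And>x. \<lbrakk>\<And>k. x k \<in> X; \<And>k. dist (f (x k)) (x (k + 1)) < d\<rbrakk> \<Longrightarrow>
      \<exists>y\<in>X. \<forall>k. dist (F k y) (x k) < h"
    using shadowing h(1) unfolding shadowing_def by metis
  obtain M1 where M1: "\<And>k. k \<ge> M1 \<Longrightarrow> dist (F k a) (F k b) < d / 2"
    using b(4) d unfolding fwd_asymp_def by (meson half_gt_zero)
  obtain M2 where M2: "\<And>k. k \<le> M2 \<Longrightarrow> dist (F k a) (F k b) < d / 2"
    using b(3) d unfolding bwd_asymp_def by (meson half_gt_zero)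
  \<comment> \<open>At times \<open>m\<close> and \<open>- m\<close> the orbits of \<open>a\<close>
    and \<open>b\<close> are so close that one can be exchanged for the other at cost
    \<open>d / 2\<close>.\<close>
  define m where "m = nat (max 1 (max M1 (- M2)))"
  have "int m = max 1 (max M1 (- M2))" by (simp add: m_def)
  then have m: "m \<ge> 1" "M1 \<le> int m" "- int m \<le> M2" by linarith+
  have far: "dist (F (int m) a) (F (int m) b) < d / 2" "dist (F (- int m) a) (F (- int m) b) < d / 2"
    using M1 M2 m by auto
  have "reach (F (int m) a) (F (- int m) a)"
    using reach_F[OF ra] reach_trans by blast
  then have "(F (int m) a, F (- int m) a) \<in> (step (d / 2))\<^sup>+"
    using d by (simp add: reach_def)
  then obtain l u where l: "0 < l" and u: "u 0 = F (int m) a" "u l = F (- int m) a"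
    "\<forall>i<l. (u i, u (Suc i)) \<in> step (d / 2)"
    by (auto simp: trancl_power relpow_fun_conv)
  have ustep: "u i \<in> X" "dist (f (u i)) (u (Suc i)) < d / 2" if "i < l" for i
    using u(3) that by (auto simp: step_def)
  define N where "N = 2 * m + l"
  have N: "N \<ge> 1" "m < N" "2 * m < N" using m l by (auto simp: N_def)
  define c where "c v = (if v then a else b)" for v
  have cX: "c v \<in> X" for v using a b by (simp add: c_def)
  have cfar: "dist (F (int m) (c v)) (F (int m) a) < d / 2"
    "dist (F (- int m) a) (F (- int m) (c v)) < d / 2" for v
    using far d by (auto simp: c_def dist_commute)
  \<comment> \<open>Index \<open>i\<close> stands for time \<open>i - m\<close>, so
    \<open>c v\<close> itself sits at index \<open>m\<close>. The return chain is common to both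
    loops.\<close>
  define Q where "Q v i = (if i < 2 * m then F (int i - int m) (c v) else u (i - 2 * m))" for v and i :: nat
  have QX: "Q v i \<in> X" if "i < N" for v i
    using that cX ustep(1) by (auto simp: Q_def F_in N_def)
  have Qm: "Q v m = c v" for v using m by (simp add: Q_def)
  have Qd: "dist (Q v i) (Q v' i) \<le> e" for v v' i
    using ab[of "int i - int m"] e by (auto simp: Q_def c_def dist_commute)
  have Q1: "dist (f (Q v i)) (Q v (Suc i)) < d" if "Suc i < N" for v i
  proof -
    consider "Suc i < 2 * m" | "Suc i = 2 * m" | "2 * m \<le> i" by linarith
    then show ?thesis
    proof cases
      case 1
      have "int (Suc i) - int m = int i - int m + 1" by simp
      then have "F (int (Suc i) - int m) (c v) = f (F (int i - int m) (c v))"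
        using F_Suc[OF cX] by metis
      then show ?thesis using 1 d by (simp add: Q_def)
    next
      case 2
      have "int m = int i - int m + 1" using 2 by simp
      then have "F (int m) (c v) = f (F (int i - int m) (c v))"
        using F_Suc[OF cX] by metis
      then show ?thesis using 2 u(1) cfar(1)[of v] d by (simp add: Q_def)
    next
      case 3
      then have "Suc i - 2 * m = Suc (i - 2 * m)" by simp
      moreover have "i - 2 * m < l" using 3 that by (simp add: N_def)
      ultimately show ?thesis using 3 ustep(2)[of "i - 2 * m"] d by (simp add: Q_def)
    qed
  qed
  \<comment> \<open>The return chain leads to \<open>F (- int m) a\<close>; half of \<open>d\<close>
    pays for its last jump and half for entering either loop.\<close>
  have Q2: "dist (f (Q v (N - 1))) (Q v' 0) < d" for v v'
  proof -
    have "\<not> N - 1 < 2 * m" "N - 1 - 2 * m = l - 1" using l by (auto simp: N_def)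
    then have "Q v (N - 1) = u (l - 1)" by (simp add: Q_def)
    moreover have "dist (f (u (l - 1))) (F (- int m) a) < d / 2"
      using ustep(2)[of "l - 1"] l u(2) by simp
    moreover have "Q v' 0 = F (- int m) (c v')" using m by (simp add: Q_def)
    ultimately show ?thesis
      using cfar(2)[of v'] dist_triangle[of "f (u (l - 1))" "F (- int m) (c v')" "F (- int m) a"] by simp
  qed

  define K where "K = {z \<in> X. \<forall>j. \<exists>v. \<forall>i<N. dist (F (j * int N + int i) z) (Q v i) \<le> h}"
  have KX: "K \<subseteq> X" by (auto simp: K_def)
  have cl: "closed {z \<in> X. dist (F k z) q \<le> h}" for k q
    by (intro continuous_on_closed_Collect_le continuous_intros F_cont compact_imp_closed cpt)
  \<comment> \<open>For each block the union is over the two symbols only, so closedness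
    survives.\<close>
  define C where "C = (\<Inter>j. \<Union>v. \<Inter>i\<in>{..<N}. {z \<in> X. dist (F (j * int N + int i) z) (Q v i) \<le> h})"
  have "closed C"
    unfolding C_def by (intro closed_INT closed_UN ballI cl finite)
  moreover have "K = X \<inter> C"
  proof (intro set_eqI iffI)
    fix z assume "z \<in> X \<inter> C"
    then have "z \<in> X" "\<forall>j. \<exists>v. \<forall>i\<in>{..<N}. dist (F (j * int N + int i) z) (Q v i) \<le> h"
      by (simp_all add: C_def) meson
    then show "z \<in> K" by (simp add: K_def lessThan_def)
  next
    fix z assume "z \<in> K"
    then show "z \<in> X \<inter> C" by (simp add: K_def C_def) (meson lessThan_iff)
  qed
  ultimately have cK: "compact K" by (simp add: compact_Int_closed[OF cpt])

  have shiftK: "F (n * int N) z \<in> K" if "z \<in> K" for z n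
  proof -
    have z: "z \<in> X" using that KX by blast
    have "\<exists>v. \<forall>i<N. dist (F (j * int N + int i) (F (n * int N) z)) (Q v i) \<le> h" for j
    proof -
      have "F (j * int N + int i) (F (n * int N) z) = F ((j + n) * int N + int i) z" for i
        using F_add[OF z, of "j * int N + int i" "n * int N"] by (simp add: algebra_simps)
      then show ?thesis using that by (simp add: K_def)
    qed
    then show ?thesis using F_in[OF z] by (simp add: K_def)
  qed
  have inv: "(f ^^ N) ` K = K"
  proof
    show "(f ^^ N) ` K \<subseteq> K"
      using shiftK[of _ 1] by (auto simp: F_nat)
    show "K \<subseteq> (f ^^ N) ` K"
    proof
      fix z assume z: "z \<in> K"
      have "z = F (int N) (F (- int N) z)"
        using z KX by (auto simp flip: F_add)
      moreover have "F (- int N) z \<in> K" using shiftK[OF z, of "- 1"] by simp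
      ultimately show "z \<in> (f ^^ N) ` K" unfolding F_nat by blast
    qed
  qed

  have diam: "diameter (F k ` K) \<le> 3 * e" for k
  proof (rule diameter_le_dist)
    fix x y assume "x \<in> F k ` K" "y \<in> F k ` K"
    then obtain z w where zw: "z \<in> K" "x = F k z" "w \<in> K" "y = F k w" by blast
    define i where "i = nat (k mod int N)"
    have i: "i < N" "k = (k div int N) * int N + int i"
      using N(1) by (auto simp: i_def nat_less_iff)
    have "\<exists>v. dist (F k z) (Q v i) \<le> h" if "z \<in> K" for z
    proof -
      obtain v where "\<forall>i<N. dist (F (k div int N * int N + int i) z) (Q v i) \<le> h"
        using \<open>z \<in> K\<close> unfolding K_def by blast
      then have "dist (F (k div int N * int N + int i) z) (Q v i) \<le> h" using i(1) by blast
      then show ?thesis unfolding i(2)[symmetric] by blast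
    qed
    from this[OF zw(1)] this[OF zw(3)]
    obtain v v' where "dist (F k z) (Q v i) \<le> h" "dist (F k w) (Q v' i) \<le> h" by blast
    then show "dist x y \<le> 3 * e"
      using zw Qd[of v i v'] h(2) dist_triangle[of x y "Q v i"] dist_triangle2[of "Q v i" y "Q v' i"]
      by simp
  qed (use e in simp)

  \<comment> \<open>Symbol \<open>j\<close> is read at the middle of block \<open>j\<close>, where
    the loops sit at \<open>a\<close> and \<open>b\<close>.\<close>
  define H where "H z j = (dist (F (j * int N + int m) z) a \<le> h)" for z j
  have notH: "\<not> dist y a \<le> h" if "dist y b \<le> h" for y
    using that h(3) dist_triangle3[of a b y] by auto
  have mid: "dist (F (j * int N + int m) z) a \<le> h \<or> dist (F (j * int N + int m) z) b \<le> h"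
    if "z \<in> K" for z j
  proof -
    obtain v where "\<forall>i<N. dist (F (j * int N + int i) z) (Q v i) \<le> h" using \<open>z \<in> K\<close> unfolding K_def by blast
    then have "dist (F (j * int N + int m) z) (c v) \<le> h" using N(2) Qm[of v] by auto
    then show ?thesis by (auto simp: c_def split: if_splits)
  qed
  have cont: "continuous_map (top_of_set K) shift_top H"
    unfolding shift_top_def continuous_map_componentwise_UNIV
  proof
    fix j
    define A where "A = {z \<in> X. dist (F (j * int N + int m) z) a \<le> h}"
    define B where "B = {z \<in> X. dist (F (j * int N + int m) z) b \<le> h}"
    have AB: "closed A" "closed B" by (simp_all add: A_def B_def cl)
    \<comment> \<open>The two closed sets are complementary on \<open>K\<close>, hence relatively
      open as well; this makes each coordinate continuous.\<close>
    have "K \<inter> A = K \<inter> - B" "K \<inter> B = K \<inter> - A"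
      using mid notH KX by (auto simp: A_def B_def)
    then have op: "openin (top_of_set K) (K \<inter> A)" "openin (top_of_set K) (K \<inter> B)"
      using AB by (auto simp: openin_open_Int)
    have "openin (top_of_set K) {z \<in> K. H z j \<in> U}" for U
    proof -
      have "z \<in> A \<longleftrightarrow> H z j" "z \<in> B \<longleftrightarrow> \<not> H z j" if "z \<in> K" for z
        using that mid[OF that, of j] notH KX by (auto simp: A_def B_def H_def)
      then have "{z \<in> K. H z j \<in> U} =
          (if True \<in> U then K \<inter> A else {}) \<union> (if False \<in> U then K \<inter> B else {})"
        by auto (metis (full_types))+
      then show ?thesis using op by (simp add: openin_Un)
    qed
    then show "continuous_map (top_of_set K) (discrete_topology UNIV) (\<lambda>z. H z j)"
      by (simp add: continuous_map_def)
  qed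
  have surj: "H ` K = UNIV"
  proof -
    have "\<exists>z\<in>K. H z = s" for s
    proof -
      define x where "x k = Q (s (k div int N)) (nat (k mod int N))" for k
      have x: "x (j * int N + int i) = Q (s j) i" if "i < N" for i j
        using that by (simp add: x_def)
      have "\<exists>z\<in>X. \<forall>k. dist (F k z) (x k) < h"
      proof (rule sh)
        show "x k \<in> X" for k
          unfolding x_def by (rule QX) (use N(1) in \<open>simp add: nat_less_iff\<close>)
        show "dist (f (x k)) (x (k + 1)) < d" for k
        proof -
          define i where "i = nat (k mod int N)"
          define j where "j = k div int N"
          have i: "i < N" and k: "k = j * int N + int i"
            using N(1) by (auto simp: i_def j_def nat_less_iff)
          show ?thesis
          proof (cases "Suc i < N")
            case True
            have "k + 1 = j * int N + int (Suc i)" using k by simp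
            then show ?thesis using x[OF i, of j] x[OF True, of j] Q1[OF True] k by metis
          next
            case False
            then have "i = N - 1" using i by simp
            \<comment> \<open>At the end of a block the next index starts block
              \<open>j + 1\<close>, possibly in the other loop.\<close>
            moreover from this have "k + 1 = (j + 1) * int N + int 0"
              using k N(1) by (simp add: algebra_simps of_nat_diff)
            ultimately show ?thesis
              using x[OF i, of j] x[of 0 "j + 1"] Q2 k N(1) by (metis less_le_trans zero_less_one)
          qed
        qed
      qed
      then obtain z where z: "z \<in> X" "\<And>k. dist (F k z) (x k) < h" by blast
      have zq: "dist (F (j * int N + int i) z) (Q (s j) i) \<le> h" if "i < N" for i j
        using z(2)[of "j * int N + int i"] x[OF that, of j] by simp
      then have "z \<in> K" using z(1) by (auto simp: K_def)
      moreover have "H z j = s j" for j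
        using zq[OF N(2), of j] notH Qm[of "s j"] by (auto simp: H_def c_def split: if_splits)
      ultimately show ?thesis by blast
    qed
    then show ?thesis by (metis UNIV_eq_I imageI)
  qed
  have "H ((f ^^ N) z) = shift (H z)" if "z \<in> K" for z
  proof
    fix j
    have "F (j * int N + int m) (F (int N) z) = F ((j + 1) * int N + int m) z"
      using F_add[of z "j * int N + int m" "int N"] that KX by (auto simp: algebra_simps)
    then show "H ((f ^^ N) z) j = shift (H z) j"
      by (simp add: H_def shift_def F_nat)
  qed
  then have semi: "semiconj_full_shift K (f ^^ N)"
    unfolding semiconj_full_shift_def using cont surj by blast

  have near: "dist (F (j * int N + int m) z) a \<le> 2 * e" if "z \<in> K" for z j
    using mid[OF that, of j] h ab[of 0] dist_triangle2[of "F (j * int N + int m) z" a b] by auto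
  show ?thesis
  proof (rule that[OF N(1) KX cK inv diam semi])
    fix z M assume z: "z \<in> K"
    \<comment> \<open>The blocks \<open>\<bar>M\<bar>\<close> and
      \<open>- (\<bar>M\<bar> + int m)\<close> have their middles on the required sides of
      \<open>M\<close>.\<close>
    have "\<bar>M\<bar> \<le> \<bar>M\<bar> * int N" using N(1) by (simp add: mult_le_cancel_left1)
    then have "M \<le> \<bar>M\<bar> * int N + int m" by linarith
    then show "\<exists>k\<ge>M. dist (F k z) a \<le> 2 * e" using near[OF z] by blast
    have "\<bar>M\<bar> + int m \<le> (\<bar>M\<bar> + int m) * int N"
      using N(1) mult_left_mono[of 1 "int N" "\<bar>M\<bar> + int m"] by simp
    then have "- (\<bar>M\<bar> + int m) * int N + int m \<le> M" by (simp only: mult_minus_left)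
    then show "\<exists>k\<le>M. dist (F k z) a \<le> 2 * e" using near[OF z] by blast
  qed
qed

lemma small_semi_horseshoes:
  assumes "\<not> expansive_set f g (chain_class X f x)"
  shows "small_semi_horseshoes f g (chain_class X f x)"
  unfolding small_semi_horseshoes_def
proof (intro allI impI)
  fix e :: real assume e: "e > 0"
  obtain d where d: "d > 0" "\<And>x y. reach x x \<Longrightarrow> reach y y \<Longrightarrow> dist x y \<le> d \<Longrightarrow> reach x y"
    using close_reach by blast
  \<comment> \<open>The diameter bound needs \<open>3 * r \<le> e\<close>, and
    \<open>close_reach\<close> needs \<open>2 * r \<le> d\<close> for limits of visits near
    \<open>a\<close>.\<close>
  define r where "r = min (e / 3) (d / 2)"
  have r: "r > 0" "3 * r \<le> e" "2 * r \<le> d" using e d(1) by (auto simp: r_def)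
  obtain a b where ab: "a \<in> chain_class X f x" "b \<in> X" "a \<noteq> b" "bwd_asymp a b" "fwd_asymp a b"
      "\<And>k. dist (F k a) (F k b) \<le> 4 * (r / 4)"
    using homoclinic_pair[OF assms, of "r / 4"] r(1) by auto
  have ax: "reach x a" "reach a x" using ab(1) by (auto simp: chain_class_eq)
  then have ra: "reach a a" using reach_trans by blast
  have "dist (F k a) (F k b) \<le> r" for k using ab(6)[of k] by simp
  then obtain N K where K: "1 \<le> N" "K \<subseteq> X" "compact K" "(f ^^ N) ` K = K"
    "\<And>k. diameter (F k ` K) \<le> 3 * r" "semiconj_full_shift K (f ^^ N)"
    and fut: "\<And>z M. z \<in> K \<Longrightarrow> \<exists>k\<ge>M. dist (F k z) a \<le> 2 * r"
    and pst: "\<And>z M. z \<in> K \<Longrightarrow> \<exists>k\<le>M. dist (F k z) a \<le> 2 * r"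
    using horseshoe[OF ra ab(2-5) r(1)] by blast
  have near: "reach w a" "reach a w"
    if "reach w w" "s \<longlonglongrightarrow> w" "\<And>n. dist (s n) a \<le> 2 * r" for w s
  proof -
    have "(\<lambda>n. dist (s n) a) \<longlonglongrightarrow> dist w a" by (intro tendsto_dist that(2) tendsto_const)
    then have "dist w a \<le> 2 * r" by (rule LIMSEQ_le_const2) (use that(3) in blast)
    then show "reach w a" "reach a w" using d(2) that(1) ra r(3) by (auto simp: dist_commute)
  qed
  have "z \<in> chain_class X f x" if z: "z \<in> K" for z
  proof -
    have zX: "z \<in> X" using z K(2) by blast
    \<comment> \<open>The point \<open>z\<close> is not known to be chain recurrent, so
      \<open>close_reach\<close> is applied to a limit of its visits near \<open>a\<close>, which
      is.\<close>
    obtain t where t: "\<And>n. int n \<le> t n" "\<And>n. dist (F (t n) z) a \<le> 2 * r"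
      using choice[of "\<lambda>n k. int n \<le> k \<and> dist (F k z) a \<le> 2 * r"] fut[OF z] by blast
    have "\<exists>n0. \<forall>n\<ge>n0. M \<le> t n" for M
    proof (intro exI allI impI)
      fix n assume "nat M \<le> n"
      then show "M \<le> t n" using t(1)[of n] by linarith
    qed
    then obtain w q where w: "(\<lambda>n. F (t (q n)) z) \<longlonglongrightarrow> w" "reach z w" "reach w w"
      using omega_limit[OF zX] by metis
    have "reach z x" using near(1)[OF w(3,1) t(2)] w(2) ax reach_trans by blast
    obtain t' where t': "\<And>n. t' n \<le> - int n" "\<And>n. dist (F (t' n) z) a \<le> 2 * r"
      using choice[of "\<lambda>n k. k \<le> - int n \<and> dist (F k z) a \<le> 2 * r"] pst[OF z] by blast
    have "\<exists>n0. \<forall>n\<ge>n0. t' n \<le> M" for M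
    proof (intro exI allI impI)
      fix n assume "nat (- M) \<le> n"
      then show "t' n \<le> M" using t'(1)[of n] by linarith
    qed
    then obtain w' q' where w': "(\<lambda>n. F (t' (q' n)) z) \<longlonglongrightarrow> w'" "reach w' z" "reach w' w'"
      using alpha_limit[OF zX] by metis
    have "reach x z" using near(2)[OF w'(3,1) t'(2)] w'(2) ax reach_trans by blast
    with \<open>reach z x\<close> show ?thesis using zX by (simp add: chain_class_eq)
  qed
  then have "K \<subseteq> chain_class X f x" by blast
  moreover have "diameter (F k ` K) \<le> e" for k using K(5)[of k] r(2) by linarith
  ultimately show "\<exists>N K. 1 \<le> N \<and> K \<subseteq> chain_class X f x \<and> compact K \<and> (f ^^ N) ` K = K \<and>
      (\<forall>k. diameter (F k ` K) \<le> e) \<and> semiconj_full_shift K (f ^^ N)"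
    using K by blast
qed

end

theorem theoremB:
  fixes X :: "'a::metric_space set" and f g :: "'a \<Rightarrow> 'a"
  assumes "compact X"
    and "homeomorphism X X f g"
    and "L_shadowing X f g"
  shows "shadowing X f g \<and> finite (chain_classes X f) \<and>
         (\<forall>\<Lambda>\<in>chain_classes X f. expansive_set f g \<Lambda> \<or> small_semi_horseshoes f g \<Lambda>)"
proof -
  interpret L_shadowing_homeo X f g
    using assms by unfold_locales
  show ?thesis
    using shadowing finite_chain_classes small_semi_horseshoes
    by (auto simp: chain_classes_def)
qed

end
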